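(* The cdga $B$ constructed in the context is not formal.
   Context: Everything is over $\mathbb{Q}$; $\Lambda(\cdot)$ denotes the free graded-commutative algebra. A cdga is formal if it is connected to its cohomology algebra with zero differential by a zigzag of cdga quasi-isomorphisms. Construction of $A$. $A=(\Lambda V,d)$ with $V^{\le5}$ having basis: degree 2: $X,Y$ with $dX=dY=0$; degree 3: $a,b,c$ with $da=X^2$, $db=XY$, $dc=Y^2$; degree 4: $e,f$ with $de=Ya-Xb$, $df=Yb-Xc$; degree 5: $h,i$ with $dh=Xe+ab$, $di=Yf+bc$. The space $V^{\ge6}$ is constructed inductively so as to kill all cohomology in degrees $\ge7$: choose cocycles representing a basis of degree $7$ cohomology, introduce for each of them a generator in $V^6$ mapped by $d$ to that cocycle, and repeat for degrees $8,9,\dots$ with generators in $V^7,V^8,\dots$. Put $m=Ye+ac+Xf$. Construction of $B$. $B=(A\otimes\Lambda W,d)$, containing $A$ as a sub-cdga, with $W^{\le5}$ having basis: degree 3: $\alpha,\gamma$ with $d\alpha=d\gamma=0$; degree 4: $s_{X\alpha},s_{Y\alpha},s_{X\gamma},s_{Y\gamma}$ with $ds_{X\alpha}=X\alpha$, $ds_{Y\alpha}=Y\alpha$, $ds_{X\gamma}=X\gamma$, $ds_{Y\gamma}=Y\gamma$; degree 5: $t_1,\dots,t_9$ with $dt_i=v_i$, where $v_1=m-\alpha\gamma$, $v_2=Ys_{X\alpha}-Xs_{Y\alpha}$, $v_3=Ys_{X\gamma}-Xs_{Y\gamma}$, $v_4=a\alpha-Xs_{X\alpha}$, $v_5=b\alpha-Xs_{Y\alpha}$,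 $v_6=c\alpha-Ys_{Y\alpha}$, $v_7=a\gamma-Xs_{X\gamma}$, $v_8=b\gamma-Xs_{Y\gamma}$, $v_9=c\gamma-Ys_{Y\gamma}$. The space $W^{\ge6}$ is constructed in the same inductive way, killing all cohomology in degrees $\ge7$, so that $H^{\ge7}(B)=0$. *)

theory Defs
  imports Complex_Main "HOL-Algebra.QuotRing" "HOL-Algebra.Module"
begin

section \<open>Graded-commutative algebras and cdgas over the rationals\<close>

definition rat_field :: "rat ring" where
  "rat_field = \<lparr>carrier = UNIV, mult = (*), one = 1, zero = 0, add = (+)\<rparr>"

record 'b gr_alg = "(rat, 'b) module" +
  gr :: "int \<Rightarrow> 'b set"

record 'b dg_alg = "'b gr_alg" +
  dif :: "'b \<Rightarrow> 'b"  (\<open>\<partial>\<index>\<close>)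

text \<open>The element \<open>(-1)\<^sup>k x\<close>.\<close>

definition koszul :: "('b, 'm) ring_scheme \<Rightarrow> int \<Rightarrow> 'b \<Rightarrow> 'b" where
  "koszul A k x = (if even k then x else \<ominus>\<^bsub>A\<^esub> x)"

text \<open>Gradings are indexed by all integers and are internal: the underlying space is the direct
  sum of the homogeneous parts. Non-negatively graded algebras are those with
  \<open>gr A n = {\<zero>}\<close> for \<open>n < 0\<close>.\<close>

locale graded_algebra = ring A + module rat_field A
  for A :: "('b, 'm) gr_alg_scheme" (structure) +
  assumes smult_mult_left:
      "\<lbrakk>x \<in> carrier A; y \<in> carrier A\<rbrakk> \<Longrightarrow> (r \<odot> x) \<otimes> y = r \<odot> (x \<otimes> y)"
    and smult_mult_right:
      "\<lbrakk>x \<in> carrier A; y \<in> carrier A\<rbrakk> \<Longrightarrow> x \<otimes> (r \<odot> y) = r \<odot> (x \<otimes> y)"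
    and gr_submodule: "submodule (gr A n) rat_field A"
    and one_gr: "\<one> \<in> gr A 0"
    and mult_gr: "\<lbrakk>x \<in> gr A p; y \<in> gr A q\<rbrakk> \<Longrightarrow> x \<otimes> y \<in> gr A (p + q)"
    and direct_sum: "x \<in> carrier A \<Longrightarrow>
      \<exists>!c. (\<forall>n. c n \<in> gr A n) \<and> finite {n. c n \<noteq> \<zero>} \<and> x = (\<Oplus>n\<in>{n. c n \<noteq> \<zero>}. c n)"

locale cdga = graded_algebra A for A :: "'b dg_alg" (structure) +
  assumes graded_comm: "\<lbrakk>x \<in> gr A p; y \<in> gr A q\<rbrakk> \<Longrightarrow> x \<otimes> y = koszul A (p * q) (y \<otimes> x)"
    and dif_add: "\<lbrakk>x \<in> carrier A; y \<in> carrier A\<rbrakk> \<Longrightarrow> \<partial> (x \<oplus> y) = \<partial> x \<oplus> \<partial> y"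
    and dif_smult: "x \<in> carrier A \<Longrightarrow> \<partial> (r \<odot> x) = r \<odot> \<partial> x"
    and dif_gr: "x \<in> gr A n \<Longrightarrow> \<partial> x \<in> gr A (n + 1)"
    and dif_dif: "x \<in> carrier A \<Longrightarrow> \<partial> (\<partial> x) = \<zero>"
    and leibniz: "\<lbrakk>x \<in> gr A p; y \<in> carrier A\<rbrakk> \<Longrightarrow>
      \<partial> (x \<otimes> y) = \<partial> x \<otimes> y \<oplus> koszul A p (x \<otimes> \<partial> y)"


section \<open>Cohomology, quasi-isomorphisms, formality\<close>

definition quot_gr_alg :: "('b, 'm) gr_alg_scheme \<Rightarrow> 'b set \<Rightarrow> 'b set gr_alg" where
  "quot_gr_alg A I =
    \<lparr>carrier = carrier (A Quot I), mult = mult (A Quot I), one = one (A Quot I),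
     zero = zero (A Quot I), add = add (A Quot I),
     smult = (\<lambda>q S. \<Union>x\<in>S. I +>\<^bsub>A\<^esub> (q \<odot>\<^bsub>A\<^esub> x)),
     gr = (\<lambda>n. {I +>\<^bsub>A\<^esub> x | x. x \<in> gr A n})\<rparr>"

definition with_dif :: "'b gr_alg \<Rightarrow> ('b \<Rightarrow> 'b) \<Rightarrow> 'b dg_alg" where
  "with_dif A D = gr_alg.extend A (dg_alg.fields D)"

definition sub_dg_alg :: "'b dg_alg \<Rightarrow> 'b set \<Rightarrow> 'b dg_alg" where
  "sub_dg_alg A S = A\<lparr>carrier := S, gr := (\<lambda>n. gr A n \<inter> S)\<rparr>"

definition cocycles :: "'b dg_alg \<Rightarrow> 'b set" where
  "cocycles A = {x \<in> carrier A. \<partial>\<^bsub>A\<^esub> x = \<zero>\<^bsub>A\<^esub>}"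

definition coboundaries :: "'b dg_alg \<Rightarrow> 'b set" where
  "coboundaries A = \<partial>\<^bsub>A\<^esub> ` carrier A"

definition coho_class :: "'b dg_alg \<Rightarrow> 'b \<Rightarrow> 'b set" where
  "coho_class A x = coboundaries A +>\<^bsub>A\<^esub> x"

definition cohomology :: "'b dg_alg \<Rightarrow> 'b set dg_alg" where
  "cohomology A = with_dif (quot_gr_alg (sub_dg_alg A (cocycles A)) (coboundaries A))
                           (\<lambda>_. coboundaries A)"  \<comment> \<open>\<open>coboundaries A\<close> is the zero class\<close>

definition cdga_hom :: "'b dg_alg \<Rightarrow> 'c dg_alg \<Rightarrow> ('b \<Rightarrow> 'c) set" where
  "cdga_hom A B = {\<phi> \<in> ring_hom A B.
     (\<forall>q. \<forall>x\<in>carrier A. \<phi> (q \<odot>\<^bsub>A\<^esub> x) = q \<odot>\<^bsub>B\<^esub> \<phi> x) \<and>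
     (\<forall>n. \<phi> ` gr A n \<subseteq> gr B n) \<and>
     (\<forall>x\<in>carrier A. \<phi> (\<partial>\<^bsub>A\<^esub> x) = \<partial>\<^bsub>B\<^esub> (\<phi> x))}"

definition coho_map :: "'c dg_alg \<Rightarrow> ('b \<Rightarrow> 'c) \<Rightarrow> 'b set \<Rightarrow> 'c set" where
  "coho_map B \<phi> S = (\<Union>x\<in>S. coho_class B (\<phi> x))"

definition quasi_iso :: "'b dg_alg \<Rightarrow> 'c dg_alg \<Rightarrow> ('b \<Rightarrow> 'c) \<Rightarrow> bool" where
  "quasi_iso A B \<phi> \<longleftrightarrow> cdga A \<and> cdga B \<and> \<phi> \<in> cdga_hom A B \<and>
     bij_betw (coho_map B \<phi>) (carrier (cohomology A)) (carrier (cohomology B))"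

definition qi_linked :: "'b dg_alg \<Rightarrow> 'c dg_alg \<Rightarrow> bool" where
  "qi_linked A B \<longleftrightarrow> (\<exists>\<phi>. quasi_iso A B \<phi>) \<or> (\<exists>\<phi>. quasi_iso B A \<phi>)"

text \<open>HOL cannot quantify over types inside a formula, so the intermediate cdgas of the zigzag
  all live on one type \<open>'u\<close>, which is a parameter. The cdgas of any finite zigzag can be
  transported to a common type (e.g. the sum of their types), and a zigzag can be padded with
  identities; hence a cdga is formal iff \<open>formal TYPE('u)\<close> holds for some type \<open>'u\<close>, and
  non-formality is \<open>\<not> formal TYPE('u) A\<close> for a free type variable \<open>'u\<close>.\<close>

definition formal :: "'u itself \<Rightarrow> 'b dg_alg \<Rightarrow> bool" where
  "formal _ A \<longleftrightarrow> (\<exists>(C :: 'u dg_alg) D.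
     qi_linked A C \<and> qi_linked\<^sup>*\<^sup>* C D \<and> qi_linked D (cohomology A))"


section \<open>Free graded-commutative algebras\<close>

text \<open>The tensor algebra on the vector space with basis \<open>G\<close>, as finitely supported functions on
  words, and its quotient by \<open>x \<otimes> y - (-1)\<^bsup>|x||y|\<^esup> y \<otimes> x\<close>. Graded commutativity forces \<open>x\<^sup>2 = 0\<close>
  for odd \<open>x\<close>, since 2 is invertible.\<close>

definition tensor_alg :: "'g set \<Rightarrow> ('g \<Rightarrow> int) \<Rightarrow> ('g list \<Rightarrow> rat) gr_alg" where
  "tensor_alg G \<delta> =
    (let T = {x. finite {w. x w \<noteq> 0} \<and> (\<forall>w. x w \<noteq> 0 \<longrightarrow> set w \<subseteq> G)} in
    \<lparr>carrier = T,
     mult = (\<lambda>x y w. \<Sum>k\<le>length w. x (take k w) * y (drop k w)),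
     one = (\<lambda>w. if w = [] then 1 else 0),
     zero = (\<lambda>_. 0),
     add = (\<lambda>x y w. x w + y w),
     smult = (\<lambda>q x w. q * x w),
     gr = (\<lambda>n. {x \<in> T. \<forall>w. x w \<noteq> 0 \<longrightarrow> sum_list (map \<delta> w) = n})\<rparr>)"

definition letter :: "'g \<Rightarrow> 'g list \<Rightarrow> rat" where
  "letter g = (\<lambda>w. if w = [g] then 1 else 0)"

definition comm_ideal :: "'g set \<Rightarrow> ('g \<Rightarrow> int) \<Rightarrow> ('g list \<Rightarrow> rat) set" where
  "comm_ideal G \<delta> = (let T = tensor_alg G \<delta> in
     Idl\<^bsub>T\<^esub> {letter g \<otimes>\<^bsub>T\<^esub> letter h \<ominus>\<^bsub>T\<^esub> koszul T (\<delta> g * \<delta> h) (letter h \<otimes>\<^bsub>T\<^esub> letter g)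
           | g h. g \<in> G \<and> h \<in> G})"

definition free_gca :: "'g set \<Rightarrow> ('g \<Rightarrow> int) \<Rightarrow> ('g list \<Rightarrow> rat) set gr_alg" where
  "free_gca G \<delta> = quot_gr_alg (tensor_alg G \<delta>) (comm_ideal G \<delta>)"

definition free_gen :: "'g set \<Rightarrow> ('g \<Rightarrow> int) \<Rightarrow> 'g \<Rightarrow> ('g list \<Rightarrow> rat) set" where
  "free_gen G \<delta> g = comm_ideal G \<delta> +>\<^bsub>tensor_alg G \<delta>\<^esub> letter g"


section \<open>Generated subalgebras and bases\<close>

inductive_set subalg :: "('b, 'm) gr_alg_scheme \<Rightarrow> 'b set \<Rightarrow> 'b set"
  for A (structure) and S where
  incl: "x \<in> S \<Longrightarrow> x \<in> subalg A S"
| one: "\<one> \<in> subalg A S"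
| smult: "x \<in> subalg A S \<Longrightarrow> q \<odot> x \<in> subalg A S"
| add: "x \<in> subalg A S \<Longrightarrow> y \<in> subalg A S \<Longrightarrow> x \<oplus> y \<in> subalg A S"
| mult: "x \<in> subalg A S \<Longrightarrow> y \<in> subalg A S \<Longrightarrow> x \<otimes> y \<in> subalg A S"

text \<open>Every element of \<open>U\<close> has unique finitely supported coordinates; uniqueness for \<open>0 \<in> U\<close> is
  linear independence.\<close>

definition is_basis :: "(rat, 'b, 'm) module_scheme \<Rightarrow> 'b set \<Rightarrow> ('j \<Rightarrow> 'b) \<Rightarrow> 'j set \<Rightarrow> bool" where
  "is_basis M U c J \<longleftrightarrow> c ` J \<subseteq> U \<and>
    (\<forall>x\<in>U. \<exists>!q. (\<forall>j. j \<notin> J \<longrightarrow> q j = 0) \<and> finite {j. q j \<noteq> 0} \<and>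
       x = (\<Oplus>\<^bsub>M\<^esub>j\<in>{j. q j \<noteq> 0}. q j \<odot>\<^bsub>M\<^esub> c j))"

text \<open>\<open>z j\<close>, \<open>j \<in> J\<close>, are cocycles of the sub-cdga \<open>S\<close> of \<open>B\<close> representing a basis of
  \<open>H\<^sup>n(S)\<close>.\<close>

definition represents_basis :: "'b dg_alg \<Rightarrow> 'b set \<Rightarrow> int \<Rightarrow> ('j \<Rightarrow> 'b) \<Rightarrow> 'j set \<Rightarrow> bool" where
  "represents_basis B S n z J \<longleftrightarrow> (let S' = sub_dg_alg B S in
     (\<forall>j\<in>J. z j \<in> gr S' n \<inter> cocycles S') \<and>
     is_basis (cohomology S') (gr (cohomology S') n) (\<lambda>j. coho_class S' (z j)) J)"


section \<open>The cdgas \<open>A\<close> and \<open>B\<close>\<close>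

text \<open>\<open>vgen n k\<close> and \<open>wgen n k\<close> (used for \<open>n \<ge> 6\<close> only) are the generators of \<open>V\<^sup>n\<close> and \<open>W\<^sup>n\<close>;
  \<open>tgen\<close> is used for the indices \<open>1, \<dots>, 9\<close> only.\<close>

datatype ('i, 'j) gens =
    gX | gY | ga | gb | gc | ge | gf | gh | gi | vgen nat 'i
  | galpha | ggamma | gsXalpha | gsYalpha | gsXgamma | gsYgamma | tgen nat | wgen nat 'j

fun gdeg :: "('i, 'j) gens \<Rightarrow> int" where
  "gdeg gX = 2" | "gdeg gY = 2"
| "gdeg ga = 3" | "gdeg gb = 3" | "gdeg gc = 3"
| "gdeg ge = 4" | "gdeg gf = 4"
| "gdeg gh = 5" | "gdeg gi = 5"
| "gdeg (vgen n k) = int n"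
| "gdeg galpha = 3" | "gdeg ggamma = 3"
| "gdeg gsXalpha = 4" | "gdeg gsYalpha = 4" | "gdeg gsXgamma = 4" | "gdeg gsYgamma = 4"
| "gdeg (tgen l) = 5"
| "gdeg (wgen n k) = int n"

definition V_gens :: "(nat \<Rightarrow> 'i set) \<Rightarrow> ('i, 'j) gens set" where
  "V_gens I = {gX, gY, ga, gb, gc, ge, gf, gh, gi} \<union> {vgen n k | n k. n \<ge> 6 \<and> k \<in> I n}"

definition W_gens :: "(nat \<Rightarrow> 'j set) \<Rightarrow> ('i, 'j) gens set" where
  "W_gens J = {galpha, ggamma, gsXalpha, gsYalpha, gsXgamma, gsYgamma} \<union> tgen ` {1..9}
     \<union> {wgen n k | n k. n \<ge> 6 \<and> k \<in> J n}"

locale B_notation =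
  fixes I :: "nat \<Rightarrow> 'i set" and J :: "nat \<Rightarrow> 'j set"
    and B :: "(('i, 'j) gens list \<Rightarrow> rat) set dg_alg" (structure)
begin

abbreviation "elt \<equiv> free_gen (V_gens I \<union> W_gens J) gdeg"
abbreviation "X \<equiv> elt gX"
abbreviation "Y \<equiv> elt gY"
abbreviation "a \<equiv> elt ga"
abbreviation "b \<equiv> elt gb"
abbreviation "c \<equiv> elt gc"
abbreviation "e \<equiv> elt ge"
abbreviation "f \<equiv> elt gf"
abbreviation "h \<equiv> elt gh"
abbreviation "i \<equiv> elt gi"
abbreviation "\<alpha> \<equiv> elt galpha"
abbreviation "\<gamma> \<equiv> elt ggamma"
abbreviation "sX\<alpha> \<equiv> elt gsXalpha"
abbreviation "sY\<alpha> \<equiv> elt gsYalpha"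
abbreviation "sX\<gamma> \<equiv> elt gsXgamma"
abbreviation "sY\<gamma> \<equiv> elt gsYgamma"
abbreviation "t l \<equiv> elt (tgen l)"
abbreviation "m \<equiv> Y \<otimes> e \<oplus> a \<otimes> c \<oplus> X \<otimes> f"

end

text \<open>The underlying graded algebra of \<open>B\<close> is \<open>\<Lambda>V \<otimes> \<Lambda>W = \<Lambda>(V \<oplus> W)\<close>, and \<open>A = (\<Lambda>V, d)\<close> is its
  sub-cdga generated by \<open>V\<close>. The index sets \<open>I n\<close>, \<open>J n\<close> and the values of the differential on
  the generators of degree at least 6 record the choices made in the construction.\<close>

locale B_construction = B_notation I J B
  for I :: "nat \<Rightarrow> 'i set" and J :: "nat \<Rightarrow> 'j set"
    and B :: "(('i, 'j) gens list \<Rightarrow> rat) set dg_alg" (structure) +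
  assumes underlying: "gr_alg.truncate B = free_gca (V_gens I \<union> W_gens J) gdeg"
    and cdga_B: "cdga B"
    and d_V: "\<partial> X = \<zero>" "\<partial> Y = \<zero>"
      "\<partial> a = X \<otimes> X" "\<partial> b = X \<otimes> Y" "\<partial> c = Y \<otimes> Y"
      "\<partial> e = Y \<otimes> a \<ominus> X \<otimes> b" "\<partial> f = Y \<otimes> b \<ominus> X \<otimes> c"
      "\<partial> h = X \<otimes> e \<oplus> a \<otimes> b" "\<partial> i = Y \<otimes> f \<oplus> b \<otimes> c"
    and d_V_high: "n \<ge> 6 \<Longrightarrow>
      represents_basis B (subalg B (elt ` {g \<in> V_gens I. gdeg g < int n})) (int n + 1)
        (\<lambda>k. \<partial> (elt (vgen n k))) (I n)"
    and d_W: "\<partial> \<alpha> = \<zero>" "\<partial> \<gamma> = \<zero>"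
      "\<partial> sX\<alpha> = X \<otimes> \<alpha>" "\<partial> sY\<alpha> = Y \<otimes> \<alpha>" "\<partial> sX\<gamma> = X \<otimes> \<gamma>" "\<partial> sY\<gamma> = Y \<otimes> \<gamma>"
      "\<partial> (t 1) = m \<ominus> \<alpha> \<otimes> \<gamma>"
      "\<partial> (t 2) = Y \<otimes> sX\<alpha> \<ominus> X \<otimes> sY\<alpha>"
      "\<partial> (t 3) = Y \<otimes> sX\<gamma> \<ominus> X \<otimes> sY\<gamma>"
      "\<partial> (t 4) = a \<otimes> \<alpha> \<ominus> X \<otimes> sX\<alpha>"
      "\<partial> (t 5) = b \<otimes> \<alpha> \<ominus> X \<otimes> sY\<alpha>"
      "\<partial> (t 6) = c \<otimes> \<alpha> \<ominus> Y \<otimes> sY\<alpha>"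
      "\<partial> (t 7) = a \<otimes> \<gamma> \<ominus> X \<otimes> sX\<gamma>"
      "\<partial> (t 8) = b \<otimes> \<gamma> \<ominus> X \<otimes> sY\<gamma>"
      "\<partial> (t 9) = c \<otimes> \<gamma> \<ominus> Y \<otimes> sY\<gamma>"
    and d_W_high: "n \<ge> 6 \<Longrightarrow>
      represents_basis B (subalg B (elt ` (V_gens I \<union> {g \<in> W_gens J. gdeg g < int n}))) (int n + 1)
        (\<lambda>k. \<partial> (elt (wgen n k))) (J n)"

end

theory Submission
  imports Defs
begin

text \<open>
  Non-formality is detected by a higher Massey product. In \<open>B\<close> the cocycle \<open>m = Ye + ac + Xf\<close> is
  cohomologous to \<open>\<alpha>\<gamma>\<close>, which is not exact, while \<open>a\<alpha> - X s\<^sub>X\<^sub>\<alpha>\<close> and \<open>a\<gamma> - X s\<^sub>X\<^sub>\<gamma>\<close> are exact;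
  moreover \<open>H\<^sup>4 = 0\<close> and the pairing of \<open>H\<^sup>3\<close> with \<open>\<alpha>\<close> and \<open>\<gamma>\<close> has trivial kernel. Existence of such
  elements is invariant under quasi-isomorphisms in both directions. If the differential is zero,
  then \<open>H\<^sup>4 = 0\<close> gives \<open>e = f = s\<^sub>X\<^sub>\<alpha> = s\<^sub>X\<^sub>\<gamma> = 0\<close>, hence \<open>a\<alpha> = a\<gamma> = 0\<close>, hence \<open>a = 0\<close> and \<open>\<alpha>\<gamma> = m = 0\<close>, a
  contradiction. In \<open>B\<close> only coefficients of words of length at most two matter; in particular
  \<open>\<alpha>\<gamma>\<close> is not exact because the sum of the coefficients of \<open>ac\<close> and \<open>\<alpha>\<gamma>\<close> vanishes on \<open>d(B\<^sup>5)\<close>.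
\<close>

section \<open>Homogeneous components\<close>

text \<open>The conditions on \<open>a \<alpha>\<close> and \<open>a \<gamma>\<close> carry the
  obstruction. A primitive \<open>a\<close> of \<open>X^2\<close> is determined only up to cocycles
  such as \<alpha> and \<gamma>, and with zero differential the choice X = Y = 0, a = \<alpha>, c =
  \<gamma>, everything else 0, satisfies every equation except the one for
  \<open>a \<gamma>\<close>. A zigzag has arrows in both directions, and against an arrow elements
  must be lifted. A quasi-isomorphism lifts cocycles only up to exact terms, whereas the equations
  are required to hold strictly. Hence every generator must be replaceable by one that differs from
  it by an exact element, with the rest of the system corrected accordingly. Moreover, bijectivity
  is given only for the total cohomology, so lifts and primitives have to be projected to
  homogeneous components. For \<open>B\<close> no basis of the free graded-commutative algebra is
  constructed: the few coefficients that matter are linear functionals vanishing on the ideal of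
  graded commutators.\<close>

locale graded_group = abelian_group G for G (structure) +
  fixes D :: "int \<Rightarrow> 'a set"
  assumes D_closed: "x \<in> D n \<Longrightarrow> x \<in> carrier G"
    and D_zero: "\<zero> \<in> D n"
    and D_add: "x \<in> D n \<Longrightarrow> y \<in> D n \<Longrightarrow> x \<oplus> y \<in> D n"
    and D_direct_sum: "x \<in> carrier G \<Longrightarrow>
      \<exists>!c. (\<forall>n. c n \<in> D n) \<and> finite {n. c n \<noteq> \<zero>} \<and> x = (\<Oplus>n\<in>{n. c n \<noteq> \<zero>}. c n)"
begin

text \<open>The finite set \<open>F\<close> need only contain the support of \<open>c\<close>, so
  that decompositions of two elements can be summed over a common index set;
  \<open>D_direct_sum\<close> itself speaks of the exact support.\<close>

definition homogeneous_parts :: "(int \<Rightarrow> 'a) \<Rightarrow> int set \<Rightarrow> bool" where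
  "homogeneous_parts c F \<longleftrightarrow> finite F \<and> (\<forall>n. c n \<in> D n) \<and> (\<forall>n. n \<notin> F \<longrightarrow> c n = \<zero>)"

lemma parts_funcset: "homogeneous_parts c F \<Longrightarrow> c \<in> S \<rightarrow> carrier G"
  using D_closed by (auto simp: homogeneous_parts_def)

lemma finsum_parts_superset:
  assumes "homogeneous_parts c F" "finite F'" "F \<subseteq> F'"
  shows "(\<Oplus>n\<in>F'. c n) = (\<Oplus>n\<in>F. c n)"
  using assms parts_funcset[OF assms(1)]
  by (intro add.finprod_mono_neutral_cong_right) (auto simp: homogeneous_parts_def)

lemma parts_exist:
  assumes "x \<in> carrier G"
  obtains c F where "homogeneous_parts c F" "x = (\<Oplus>n\<in>F. c n)"
proof -
  obtain c where "(\<forall>n. c n \<in> D n) \<and> finite {n. c n \<noteq> \<zero>} \<and> x = (\<Oplus>n\<in>{n. c n \<noteq> \<zero>}. c n)"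
    using ex1_implies_ex[OF D_direct_sum[OF assms]] by blast
  then show thesis
    by (intro that[of c "{n. c n \<noteq> \<zero>}"]) (auto simp: homogeneous_parts_def)
qed

lemma parts_unique:
  assumes "homogeneous_parts c F" "homogeneous_parts c' F'" "(\<Oplus>n\<in>F. c n) = (\<Oplus>n\<in>F'. c' n)"
  shows "c = c'"
proof -
  have *: "finite {n. d n \<noteq> \<zero>} \<and> (\<Oplus>n\<in>F. d n) = (\<Oplus>n\<in>{n. d n \<noteq> \<zero>}. d n)"
    if "homogeneous_parts d F" for d F
  proof -
    have "{n. d n \<noteq> \<zero>} \<subseteq> F" "finite F"
      using that by (auto simp: homogeneous_parts_def)
    moreover from this have "homogeneous_parts d {n. d n \<noteq> \<zero>}"
      using that finite_subset by (auto simp: homogeneous_parts_def)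
    ultimately show ?thesis
      using finsum_parts_superset by (simp add: homogeneous_parts_def)
  qed
  let ?P = "\<lambda>d. (\<forall>n. d n \<in> D n) \<and> finite {n. d n \<noteq> \<zero>} \<and>
    (\<Oplus>n\<in>F. c n) = (\<Oplus>n\<in>{n. d n \<noteq> \<zero>}. d n)"
  have "(\<Oplus>n\<in>F. c n) \<in> carrier G"
    using finsum_closed[OF parts_funcset[OF assms(1)]] .
  then have "\<exists>!d. ?P d"
    by (rule D_direct_sum)
  moreover have "?P c"
    using *[OF assms(1)] assms(1) by (simp add: homogeneous_parts_def)
  moreover have "?P c'"
    using *[OF assms(2)] assms(2,3) by (simp add: homogeneous_parts_def)
  ultimately show ?thesis
    by blast
qed

definition component :: "int \<Rightarrow> 'a \<Rightarrow> 'a" where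
  "component n x = (THE c. \<exists>F. homogeneous_parts c F \<and> x = (\<Oplus>n\<in>F. c n)) n"

lemma component_finsum:
  assumes "homogeneous_parts c F"
  shows "component n (\<Oplus>n\<in>F. c n) = c n"
proof -
  have "(THE c'. \<exists>F'. homogeneous_parts c' F' \<and> (\<Oplus>n\<in>F. c n) = (\<Oplus>n\<in>F'. c' n)) = c"
    using assms parts_unique by (intro the_equality) metis+
  then show ?thesis
    by (simp add: component_def)
qed

lemma component_in: "x \<in> carrier G \<Longrightarrow> component n x \<in> D n"
  using component_finsum by (elim parts_exist) (auto simp: homogeneous_parts_def)

lemma component_homogeneous:
  assumes "x \<in> D n"
  shows "component n x = x"
proof -
  have "homogeneous_parts (\<lambda>k. if k = n then x else \<zero>) {n}"
    using assms D_zero by (simp add: homogeneous_parts_def)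
  from component_finsum[OF this, of n] show ?thesis
    using D_closed[OF assms] by (simp add: finsum_insert)
qed

lemma component_add:
  assumes "x \<in> carrier G" "y \<in> carrier G"
  shows "component n (x \<oplus> y) = component n x \<oplus> component n y"
proof -
  obtain c F where c: "homogeneous_parts c F" "x = (\<Oplus>n\<in>F. c n)"
    using assms(1) by (rule parts_exist)
  obtain c' F' where c': "homogeneous_parts c' F'" "y = (\<Oplus>n\<in>F'. c' n)"
    using assms(2) by (rule parts_exist)
  have fin: "finite (F \<union> F')"
    using c c' by (auto simp: homogeneous_parts_def)
  have "x \<oplus> y = (\<Oplus>n\<in>F \<union> F'. c n) \<oplus> (\<Oplus>n\<in>F \<union> F'. c' n)"
    using finsum_parts_superset[OF c(1) fin] finsum_parts_superset[OF c'(1) fin] c c' by simp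
  also have "\<dots> = (\<Oplus>n\<in>F \<union> F'. c n \<oplus> c' n)"
    by (rule finsum_addf[symmetric]) (use c c' parts_funcset in auto)
  finally have "x \<oplus> y = (\<Oplus>n\<in>F \<union> F'. c n \<oplus> c' n)" .
  moreover have "homogeneous_parts (\<lambda>n. c n \<oplus> c' n) (F \<union> F')"
    using c(1) c'(1) D_add by (auto simp: homogeneous_parts_def)
  ultimately show ?thesis
    using component_finsum c c' by simp
qed

end

lemma additive_zero:
  assumes "abelian_group G" "abelian_group H" "\<phi> \<in> carrier G \<rightarrow> carrier H"
    and "\<And>x y. x \<in> carrier G \<Longrightarrow> y \<in> carrier G \<Longrightarrow> \<phi> (x \<oplus>\<^bsub>G\<^esub> y) = \<phi> x \<oplus>\<^bsub>H\<^esub> \<phi> y"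
  shows "\<phi> \<zero>\<^bsub>G\<^esub> = \<zero>\<^bsub>H\<^esub>"
proof -
  interpret G: abelian_group G by fact
  interpret H: abelian_group H by fact
  have "\<phi> \<zero>\<^bsub>G\<^esub> \<in> carrier H" "\<phi> \<zero>\<^bsub>G\<^esub> \<oplus>\<^bsub>H\<^esub> \<phi> \<zero>\<^bsub>G\<^esub> = \<phi> \<zero>\<^bsub>G\<^esub>"
    using assms(3) assms(4)[of "\<zero>\<^bsub>G\<^esub>" "\<zero>\<^bsub>G\<^esub>"] by auto
  then show ?thesis
    by (metis H.r_neg H.a_assoc H.a_inv_closed H.r_zero)
qed

text \<open>The axioms of a cdga locate the differential only on homogeneous elements, where
  \<open>dif_gr\<close> applies. That it preserves the whole carrier is derived here by decomposing
  the argument.\<close>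

lemma additive_map_closed:
  assumes G: "graded_group G D" and H: "abelian_group H"
    and add: "\<And>x y. x \<in> carrier G \<Longrightarrow> y \<in> carrier G \<Longrightarrow> \<phi> (x \<oplus>\<^bsub>G\<^esub> y) = \<phi> x \<oplus>\<^bsub>H\<^esub> \<phi> y"
    and homogeneous: "\<And>n x. x \<in> D n \<Longrightarrow> \<phi> x \<in> carrier H"
    and x: "x \<in> carrier G"
  shows "\<phi> x \<in> carrier H"
proof -
  interpret G: graded_group G D by fact
  interpret H: abelian_group H by fact
  obtain c F where c: "G.homogeneous_parts c F" "x = (\<Oplus>\<^bsub>G\<^esub>n\<in>F. c n)"
    using x by (rule G.parts_exist)
  have c_in: "c n \<in> carrier G" for n
    using G.parts_funcset[OF c(1), of UNIV] by auto
  have phi_in: "\<phi> (c n) \<in> carrier H" for n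
    using c(1) homogeneous by (auto simp: G.homogeneous_parts_def)
  have "finite S \<Longrightarrow> \<phi> (\<Oplus>\<^bsub>G\<^esub>n\<in>S. c n) \<in> carrier H" for S
  proof (induction rule: finite_induct)
    case empty
    show ?case
      using homogeneous G.D_zero by simp
  next
    case (insert m S)
    moreover have "(\<Oplus>\<^bsub>G\<^esub>n\<in>S. c n) \<in> carrier G"
      using c_in by (intro G.finsum_closed) auto
    ultimately show ?case
      using c_in phi_in by (simp add: G.finsum_insert add)
  qed
  then show ?thesis
    using c by (simp add: G.homogeneous_parts_def)
qed

text \<open>The shift \<open>k\<close> is 1 for the differential and 0 for a morphism. The images of
  the components of \<open>x\<close>, reindexed by \<open>n + k\<close>, form a decomposition of
  \<open>\<phi> x\<close>, and decompositions are unique.\<close>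

lemma component_additive_map:
  assumes G: "graded_group G D" and H: "graded_group H E" and cl: "\<phi> \<in> carrier G \<rightarrow> carrier H"
    and add: "\<And>x y. x \<in> carrier G \<Longrightarrow> y \<in> carrier G \<Longrightarrow> \<phi> (x \<oplus>\<^bsub>G\<^esub> y) = \<phi> x \<oplus>\<^bsub>H\<^esub> \<phi> y"
    and shift: "\<And>n x. x \<in> D n \<Longrightarrow> \<phi> x \<in> E (n + k)"
    and x: "x \<in> carrier G"
  shows "graded_group.component H E (n + k) (\<phi> x) = \<phi> (graded_group.component G D n x)"
proof -
  interpret G: graded_group G D by fact
  interpret H: graded_group H E by fact
  have zero: "\<phi> \<zero>\<^bsub>G\<^esub> = \<zero>\<^bsub>H\<^esub>"
    using additive_zero[OF G.abelian_group_axioms H.abelian_group_axioms cl add] .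
  obtain c F where c: "G.homogeneous_parts c F" "x = (\<Oplus>\<^bsub>G\<^esub>n\<in>F. c n)"
    using x by (rule G.parts_exist)
  have fin: "finite F"
    using c by (simp add: G.homogeneous_parts_def)
  have c_in: "c n \<in> carrier G" for n
    using G.parts_funcset[OF c(1), of UNIV] by auto
  have phi_in: "\<phi> (c n) \<in> carrier H" for n
    using cl c_in by auto
  have hom: "\<phi> (\<Oplus>\<^bsub>G\<^esub>n\<in>S. c n) = (\<Oplus>\<^bsub>H\<^esub>n\<in>S. \<phi> (c n))" if "finite S" for S
    using that
  proof induction
    case empty
    show ?case by (simp add: zero)
  next
    case (insert m S)
    then have "\<phi> (\<Oplus>\<^bsub>G\<^esub>n\<in>insert m S. c n) = \<phi> (c m \<oplus>\<^bsub>G\<^esub> (\<Oplus>\<^bsub>G\<^esub>n\<in>S. c n))"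
      using c_in by (simp add: G.finsum_insert)
    also have "\<dots> = \<phi> (c m) \<oplus>\<^bsub>H\<^esub> \<phi> (\<Oplus>\<^bsub>G\<^esub>n\<in>S. c n)"
      using c_in by (intro add G.finsum_closed) auto
    finally show ?case
      using insert phi_in by (simp add: H.finsum_insert)
  qed
  let ?d = "\<lambda>m. \<phi> (c (m - k))"
  have "(\<Oplus>\<^bsub>H\<^esub>m\<in>(\<lambda>n. n + k) ` F. ?d m) = (\<Oplus>\<^bsub>H\<^esub>n\<in>F. \<phi> (c n))"
    using phi_in H.finsum_reindex[of ?d "\<lambda>n. n + k" F] by (simp add: inj_on_def)
  then have "\<phi> x = (\<Oplus>\<^bsub>H\<^esub>m\<in>(\<lambda>n. n + k) ` F. ?d m)"
    using hom[OF fin] c by simp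
  moreover have "H.homogeneous_parts ?d ((\<lambda>n. n + k) ` F)"
  proof -
    have "\<phi> (c (m - k)) \<in> E m" for m
      using shift[of "c (m - k)" "m - k"] c(1) by (simp add: G.homogeneous_parts_def)
    moreover have "\<phi> (c (m - k)) = \<zero>\<^bsub>H\<^esub>" if "m \<notin> (\<lambda>n. n + k) ` F" for m
    proof -
      have "m - k \<notin> F"
        using that by (metis diff_add_cancel image_eqI)
      then show ?thesis
        using c(1) zero by (simp add: G.homogeneous_parts_def)
    qed
    ultimately show ?thesis
      using fin by (simp add: H.homogeneous_parts_def)
  qed
  ultimately show ?thesis
    using H.component_finsum[of ?d _ "n + k"] G.component_finsum[OF c(1)] c(2) by simp
qed

section \<open>Closure, sign and degree rules in a cdga\<close>

lemma cdga_ring: "cdga A \<Longrightarrow> ring A"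
  unfolding cdga_def graded_algebra_def by blast

context cdga
begin

(* Plain names such as m_assoc denote here the facts about rat_field. *)
lemmas ring_A = cdga_ring[OF cdga_axioms]
lemmas abelian_A = ring.is_abelian_group[OF ring_A]
lemmas alg_simps = ring.ring_simprules[OF ring_A]
lemmas A_assoc = alg_simps(11)

lemma add_diff_cancel: "x \<in> carrier A \<Longrightarrow> y \<in> carrier A \<Longrightarrow> x \<oplus> (y \<ominus> x) = y"
  by algebra

lemma gr_closed: "x \<in> gr A n \<Longrightarrow> x \<in> carrier A"
  using submoduleE(1)[OF gr_submodule] by blast

lemma gr_add: "x \<in> gr A n \<Longrightarrow> y \<in> gr A n \<Longrightarrow> x \<oplus> y \<in> gr A n"
  using submoduleE(5)[OF gr_submodule] by blast

lemma gr_minus: "x \<in> gr A n \<Longrightarrow> \<ominus> x \<in> gr A n"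
  using submoduleE(3)[OF gr_submodule] by blast

lemma gr_diff: "x \<in> gr A n \<Longrightarrow> y \<in> gr A n \<Longrightarrow> x \<ominus> y \<in> gr A n"
  by (simp add: a_minus_def gr_add gr_minus)

lemma gr_zero: "\<zero> \<in> gr A n"
proof -
  obtain x where "x \<in> gr A n"
    using submoduleE(2)[OF gr_submodule[of n]] by blast
  then show ?thesis
    using gr_add[OF _ gr_minus, of x n x] by (simp add: gr_closed alg_simps)
qed

lemma graded_group: "graded_group A (gr A)"
  using abelian_A gr_closed gr_zero gr_add direct_sum
  by (intro graded_group.intro graded_group_axioms.intro)

lemma dif_closed: "x \<in> carrier A \<Longrightarrow> \<partial> x \<in> carrier A"
  using additive_map_closed[OF graded_group abelian_A, of "dif A"] dif_add gr_closed[OF dif_gr]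
  by blast

lemma dif_zero: "\<partial> \<zero> = \<zero>"
  using additive_zero[OF abelian_A abelian_A, of "dif A"] dif_closed dif_add by auto

lemma dif_uminus: "x \<in> carrier A \<Longrightarrow> \<partial> (\<ominus> x) = \<ominus> \<partial> x"
  using dif_add[of x "\<ominus> x"] abelian_group.minus_equality[OF abelian_A, of "\<partial> (\<ominus> x)" "\<partial> x"]
  by (simp add: alg_simps dif_closed dif_zero)

lemma leibniz_even: "x \<in> gr A p \<Longrightarrow> even p \<Longrightarrow> y \<in> carrier A \<Longrightarrow>
    \<partial> (x \<otimes> y) = \<partial> x \<otimes> y \<oplus> x \<otimes> \<partial> y"
  by (simp add: leibniz koszul_def)

lemma leibniz_odd: "x \<in> gr A p \<Longrightarrow> odd p \<Longrightarrow> y \<in> carrier A \<Longrightarrow>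
    \<partial> (x \<otimes> y) = \<partial> x \<otimes> y \<ominus> x \<otimes> \<partial> y"
  by (simp add: leibniz koszul_def a_minus_def)

text \<open>The second rule exchanges two factors at the head of a right-nested product, where the
  first does not match; together with associativity the two sort monomials.\<close>

lemma comm_even:
  assumes "u \<in> gr A p" "v \<in> gr A q" "even (p * q)"
  shows "v \<otimes> u = u \<otimes> v" "z \<in> carrier A \<Longrightarrow> v \<otimes> (u \<otimes> z) = u \<otimes> (v \<otimes> z)"
proof -
  note uv = assms(1,2)[THEN gr_closed]
  show *: "v \<otimes> u = u \<otimes> v"
    using graded_comm[OF assms(1,2)] assms(3) by (simp add: koszul_def)
  show "v \<otimes> (u \<otimes> z) = u \<otimes> (v \<otimes> z)" if "z \<in> carrier A"
    using that uv A_assoc[of v u z] A_assoc[of u v z] by (simp add: *)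
qed

lemma comm_odd:
  assumes "u \<in> gr A p" "v \<in> gr A q" "odd (p * q)"
  shows "v \<otimes> u = \<ominus> (u \<otimes> v)" "z \<in> carrier A \<Longrightarrow> v \<otimes> (u \<otimes> z) = \<ominus> (u \<otimes> (v \<otimes> z))"
proof -
  note uv = assms(1,2)[THEN gr_closed]
  show *: "v \<otimes> u = \<ominus> (u \<otimes> v)"
    using graded_comm[OF assms(2,1)] assms(3) by (simp add: koszul_def mult.commute)
  show "v \<otimes> (u \<otimes> z) = \<ominus> (u \<otimes> (v \<otimes> z))" if "z \<in> carrier A"
    using that uv A_assoc[of v u z] A_assoc[of u v z] by (simp add: * alg_simps(5,26))
qed

lemma mult_low_degree:
  "u \<in> gr A 1 \<Longrightarrow> v \<in> gr A 2 \<Longrightarrow> u \<otimes> v \<in> gr A 3"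
  "u \<in> gr A 2 \<Longrightarrow> v \<in> gr A 1 \<Longrightarrow> u \<otimes> v \<in> gr A 3"
  "u \<in> gr A 2 \<Longrightarrow> v \<in> gr A 2 \<Longrightarrow> u \<otimes> v \<in> gr A 4"
  "u \<in> gr A 1 \<Longrightarrow> v \<in> gr A 3 \<Longrightarrow> u \<otimes> v \<in> gr A 4"
  "u \<in> gr A 1 \<Longrightarrow> v \<in> gr A 4 \<Longrightarrow> u \<otimes> v \<in> gr A 5"
  "u \<in> gr A 2 \<Longrightarrow> v \<in> gr A 3 \<Longrightarrow> u \<otimes> v \<in> gr A 5"
  "u \<in> gr A 3 \<Longrightarrow> v \<in> gr A 2 \<Longrightarrow> u \<otimes> v \<in> gr A 5"
  "u \<in> gr A 2 \<Longrightarrow> v \<in> gr A 4 \<Longrightarrow> u \<otimes> v \<in> gr A 6"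
  "u \<in> gr A 3 \<Longrightarrow> v \<in> gr A 3 \<Longrightarrow> u \<otimes> v \<in> gr A 6"
  using mult_gr[of u _ v] by force+

end

section \<open>Massey systems\<close>

text \<open>\<open>s\<close> and \<open>r\<close> stand for \<open>s\<^sub>X\<^sub>\<alpha>\<close> and \<open>s\<^sub>X\<^sub>\<gamma>\<close>, and \<open>T1\<close>, \<open>T4\<close>, \<open>T7\<close> for \<open>t\<^sub>1\<close>, \<open>t\<^sub>4\<close>, \<open>t\<^sub>7\<close>.\<close>

locale massey = cdga A for A :: "'b dg_alg" (structure) +
  fixes X Y a b c e f \<alpha> \<gamma> s r T1 T4 T7
  assumes in_gr: "X \<in> gr A 2" "Y \<in> gr A 2" "a \<in> gr A 3" "b \<in> gr A 3" "c \<in> gr A 3"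
      "e \<in> gr A 4" "f \<in> gr A 4" "\<alpha> \<in> gr A 3" "\<gamma> \<in> gr A 3" "s \<in> gr A 4" "r \<in> gr A 4"
      "T1 \<in> gr A 5" "T4 \<in> gr A 5" "T7 \<in> gr A 5"
    and dif_eqs: "\<partial> X = \<zero>" "\<partial> Y = \<zero>"
      "\<partial> a = X \<otimes> X" "\<partial> b = X \<otimes> Y" "\<partial> c = Y \<otimes> Y"
      "\<partial> e = Y \<otimes> a \<ominus> X \<otimes> b" "\<partial> f = Y \<otimes> b \<ominus> X \<otimes> c"
      "\<partial> \<alpha> = \<zero>" "\<partial> \<gamma> = \<zero>" "\<partial> s = X \<otimes> \<alpha>" "\<partial> r = X \<otimes> \<gamma>"
      "\<partial> T1 = Y \<otimes> e \<oplus> a \<otimes> c \<oplus> X \<otimes> f \<ominus> \<alpha> \<otimes> \<gamma>"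
      "\<partial> T4 = a \<otimes> \<alpha> \<ominus> X \<otimes> s"
      "\<partial> T7 = a \<otimes> \<gamma> \<ominus> X \<otimes> r"
begin

lemmas in_carrier = in_gr[THEN gr_closed]

lemmas in_gr_intros = in_gr mult_low_degree gr_add gr_diff

text \<open>The lemmas \<open>move_*\<close> change one generator \<open>g\<close> by \<open>\<partial> z\<close>; the formulas for the other
  generators are those of the automorphism \<open>exp (d\<theta> + \<theta>d)\<close> of the free algebra, where the
  derivation \<open>\<theta>\<close> maps \<open>g\<close> to \<open>z\<close> and all other generators to 0.\<close>

lemma move_X:
  assumes z: "z \<in> gr A 1"
  shows "massey A (X \<oplus> \<partial> z) Y (a \<oplus> (X \<otimes> z \<oplus> X \<otimes> z \<oplus> z \<otimes> \<partial> z)) (b \<oplus> z \<otimes> Y) c (e \<ominus> z \<otimes> b)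
      (f \<ominus> z \<otimes> c) \<alpha> \<gamma> (s \<oplus> z \<otimes> \<alpha>) (r \<oplus> z \<otimes> \<gamma>) (T1 \<oplus> z \<otimes> f) (T4 \<ominus> z \<otimes> s) (T7 \<ominus> z \<otimes> r)"
proof -
  have dz: "\<partial> z \<in> gr A 2"
    using dif_gr[OF z] by simp
  note closed = in_carrier z[THEN gr_closed] dz[THEN gr_closed]
  note product_rules = leibniz_odd[OF z] leibniz_even[OF in_gr(1)] leibniz_even[OF in_gr(2)]
      leibniz_even[OF dz]
  note commutation = comm_even[OF in_gr(1) in_gr(2), simplified]
      comm_even[OF in_gr(1) z, simplified] comm_even[OF in_gr(2) z, simplified]
      comm_even[OF dz z, simplified] comm_even[OF in_gr(1) dz, simplified]
      comm_even[OF in_gr(2) dz, simplified]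
  show ?thesis
    by (unfold_locales, simp_all add: in_gr_intros z dz,
        simp_all add: alg_simps dif_add dif_uminus dif_eqs dif_dif closed product_rules commutation)
      (use closed in algebra)
qed

text \<open>Since \<open>z\<close> is odd, \<open>z \<otimes> z = 0\<close>, which cuts off the
  exponential series. Only \<open>c\<close>, whose differential is the square of \<open>Y\<close>,
  receives a second-order term, \<open>z \<otimes> \<partial> z\<close>; in \<open>move_X\<close>
  the same happens to \<open>a\<close>.\<close>

lemma move_Y:
  assumes z: "z \<in> gr A 1"
  shows "massey A X (Y \<oplus> \<partial> z) a (b \<oplus> X \<otimes> z) (c \<oplus> (Y \<otimes> z \<oplus> Y \<otimes> z \<oplus> z \<otimes> \<partial> z)) (e \<oplus> z \<otimes> a)
      (f \<oplus> z \<otimes> b) \<alpha> \<gamma> s r (T1 \<oplus> z \<otimes> e) T4 T7"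
proof -
  have dz: "\<partial> z \<in> gr A 2"
    using dif_gr[OF z] by simp
  note closed = in_carrier z[THEN gr_closed] dz[THEN gr_closed]
  note product_rules = leibniz_odd[OF z] leibniz_even[OF in_gr(1)] leibniz_even[OF in_gr(2)]
      leibniz_even[OF dz]
  note commutation = comm_even[OF in_gr(1) in_gr(2), simplified]
      comm_even[OF in_gr(1) z, simplified] comm_even[OF in_gr(2) z, simplified]
      comm_even[OF dz z, simplified] comm_even[OF in_gr(1) dz, simplified]
      comm_even[OF in_gr(2) dz, simplified] comm_odd[OF z in_gr(3), simplified]
      comm_even[OF dz in_gr(3), simplified] comm_even[OF in_gr(2) in_gr(3), simplified]
  show ?thesis
    by (unfold_locales, simp_all add: in_gr_intros z dz,
        simp_all add: alg_simps dif_add dif_uminus dif_eqs dif_dif closed product_rules commutation)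
qed

lemma move_a:
  assumes z: "z \<in> gr A 2"
  shows "massey A X Y (a \<oplus> \<partial> z) b c (e \<oplus> Y \<otimes> z) f \<alpha> \<gamma> s r (T1 \<oplus> z \<otimes> c) (T4 \<oplus> z \<otimes> \<alpha>) (T7 \<oplus> z \<otimes> \<gamma>)"
proof -
  have dz: "\<partial> z \<in> gr A 3"
    using dif_gr[OF z] by simp
  note closed = in_carrier z[THEN gr_closed] dz[THEN gr_closed]
  note product_rules = leibniz_even[OF z] leibniz_even[OF in_gr(1)] leibniz_even[OF in_gr(2)]
  note commutation = comm_even[OF in_gr(1) in_gr(2), simplified]
      comm_even[OF in_gr(1) z, simplified] comm_even[OF in_gr(2) z, simplified]
      comm_even[OF in_gr(1) dz, simplified] comm_even[OF in_gr(2) dz, simplified]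
  show ?thesis
    by (unfold_locales, simp_all add: in_gr_intros z dz,
        simp_all add: alg_simps dif_add dif_uminus dif_eqs dif_dif closed product_rules commutation)
qed

text \<open>The corrections of \<open>e\<close> and \<open>f\<close> contribute
  \<open>- Y X z\<close> and \<open>X Y z\<close> to \<open>Y e + a c + X f\<close>; they cancel,
  which is why \<open>T1\<close> stays fixed.\<close>

lemma move_b:
  assumes z: "z \<in> gr A 2"
  shows "massey A X Y a (b \<oplus> \<partial> z) c (e \<ominus> X \<otimes> z) (f \<oplus> Y \<otimes> z) \<alpha> \<gamma> s r T1 T4 T7"
proof -
  have dz: "\<partial> z \<in> gr A 3"
    using dif_gr[OF z] by simp
  note closed = in_carrier z[THEN gr_closed] dz[THEN gr_closed]
  note product_rules = leibniz_even[OF z] leibniz_even[OF in_gr(1)] leibniz_even[OF in_gr(2)]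
  note commutation = comm_even[OF in_gr(1) in_gr(2), simplified]
      comm_even[OF in_gr(1) z, simplified] comm_even[OF in_gr(2) z, simplified]
      comm_even[OF in_gr(1) dz, simplified] comm_even[OF in_gr(2) dz, simplified]
  show ?thesis
    by (unfold_locales, simp_all add: in_gr_intros z dz,
        simp_all add: alg_simps dif_add dif_uminus dif_eqs dif_dif closed product_rules commutation)
qed

text \<open>The sign in front of \<open>a \<otimes> z\<close> arises because the odd derivation
  passes the odd element \<open>a\<close> before it reaches \<open>c\<close>.\<close>

lemma move_c:
  assumes z: "z \<in> gr A 2"
  shows "massey A X Y a b (c \<oplus> \<partial> z) e (f \<ominus> X \<otimes> z) \<alpha> \<gamma> s r (T1 \<ominus> a \<otimes> z) T4 T7"
proof -
  have dz: "\<partial> z \<in> gr A 3"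
    using dif_gr[OF z] by simp
  note closed = in_carrier z[THEN gr_closed] dz[THEN gr_closed]
  note product_rules = leibniz_even[OF z] leibniz_even[OF in_gr(1)] leibniz_even[OF in_gr(2)]
      leibniz_odd[OF in_gr(3)]
  note commutation = comm_even[OF in_gr(1) in_gr(2), simplified]
      comm_even[OF in_gr(1) z, simplified] comm_even[OF in_gr(2) z, simplified]
      comm_even[OF in_gr(1) dz, simplified] comm_even[OF in_gr(2) dz, simplified]
  show ?thesis
    by (unfold_locales, simp_all add: in_gr_intros z dz,
        simp_all add: alg_simps dif_add dif_uminus dif_eqs dif_dif closed product_rules commutation)
qed

lemma move_alpha:
  assumes z: "z \<in> gr A 2"
  shows "massey A X Y a b c e f (\<alpha> \<oplus> \<partial> z) \<gamma> (s \<oplus> X \<otimes> z) r (T1 \<ominus> z \<otimes> \<gamma>) (T4 \<ominus> a \<otimes> z) T7"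
proof -
  have dz: "\<partial> z \<in> gr A 3"
    using dif_gr[OF z] by simp
  note closed = in_carrier z[THEN gr_closed] dz[THEN gr_closed]
  note product_rules = leibniz_even[OF z] leibniz_even[OF in_gr(1)] leibniz_even[OF in_gr(2)]
      leibniz_odd[OF in_gr(3)]
  note commutation = comm_even[OF in_gr(1) in_gr(2), simplified]
      comm_even[OF in_gr(1) z, simplified] comm_even[OF in_gr(2) z, simplified]
      comm_even[OF in_gr(1) dz, simplified] comm_even[OF in_gr(2) dz, simplified]
  show ?thesis
    by (unfold_locales, simp_all add: in_gr_intros z dz,
        simp_all add: alg_simps dif_add dif_uminus dif_eqs dif_dif closed product_rules commutation)
qed

lemma move_gamma:
  assumes z: "z \<in> gr A 2"
  shows "massey A X Y a b c e f \<alpha> (\<gamma> \<oplus> \<partial> z) s (r \<oplus> X \<otimes> z) (T1 \<oplus> \<alpha> \<otimes> z) T4 (T7 \<ominus> a \<otimes> z)"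
proof -
  have dz: "\<partial> z \<in> gr A 3"
    using dif_gr[OF z] by simp
  note closed = in_carrier z[THEN gr_closed] dz[THEN gr_closed]
  note product_rules = leibniz_even[OF z] leibniz_even[OF in_gr(1)] leibniz_even[OF in_gr(2)]
      leibniz_odd[OF in_gr(3)] leibniz_odd[OF in_gr(8)]
  note commutation = comm_even[OF in_gr(1) in_gr(2), simplified]
      comm_even[OF in_gr(1) z, simplified] comm_even[OF in_gr(2) z, simplified]
      comm_even[OF in_gr(1) dz, simplified] comm_even[OF in_gr(2) dz, simplified]
  show ?thesis
    by (unfold_locales, simp_all add: in_gr_intros z dz,
        simp_all add: alg_simps dif_add dif_uminus dif_eqs dif_dif closed product_rules commutation)
qed

lemma move_e:
  assumes z: "z \<in> gr A 3"
  shows "massey A X Y a b c (e \<oplus> \<partial> z) f \<alpha> \<gamma> s r (T1 \<oplus> Y \<otimes> z) T4 T7"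
proof -
  have dz: "\<partial> z \<in> gr A 4"
    using dif_gr[OF z] by simp
  note closed = in_carrier z[THEN gr_closed] dz[THEN gr_closed]
  note product_rules = leibniz_even[OF in_gr(1)] leibniz_even[OF in_gr(2)]
  note commutation = comm_even[OF in_gr(1) in_gr(2), simplified]
  show ?thesis
    by (unfold_locales, simp_all add: in_gr_intros z dz,
        simp_all add: alg_simps dif_add dif_uminus dif_eqs dif_dif closed product_rules commutation)
qed

lemma move_f:
  assumes z: "z \<in> gr A 3"
  shows "massey A X Y a b c e (f \<oplus> \<partial> z) \<alpha> \<gamma> s r (T1 \<oplus> X \<otimes> z) T4 T7"
proof -
  have dz: "\<partial> z \<in> gr A 4"
    using dif_gr[OF z] by simp
  note closed = in_carrier z[THEN gr_closed] dz[THEN gr_closed]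
  note product_rules = leibniz_even[OF in_gr(1)] leibniz_even[OF in_gr(2)]
  note commutation = comm_even[OF in_gr(1) in_gr(2), simplified]
  show ?thesis
    by (unfold_locales, simp_all add: in_gr_intros z dz,
        simp_all add: alg_simps dif_add dif_uminus dif_eqs dif_dif closed product_rules commutation)
qed

lemma move_s:
  assumes z: "z \<in> gr A 3"
  shows "massey A X Y a b c e f \<alpha> \<gamma> (s \<oplus> \<partial> z) r T1 (T4 \<ominus> X \<otimes> z) T7"
proof -
  have dz: "\<partial> z \<in> gr A 4"
    using dif_gr[OF z] by simp
  note closed = in_carrier z[THEN gr_closed] dz[THEN gr_closed]
  note product_rules = leibniz_even[OF in_gr(1)] leibniz_even[OF in_gr(2)]
  note commutation = comm_even[OF in_gr(1) in_gr(2), simplified]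
  show ?thesis
    by (unfold_locales, simp_all add: in_gr_intros z dz,
        simp_all add: alg_simps dif_add dif_uminus dif_eqs dif_dif closed product_rules commutation)
qed

lemma move_r:
  assumes z: "z \<in> gr A 3"
  shows "massey A X Y a b c e f \<alpha> \<gamma> s (r \<oplus> \<partial> z) T1 T4 (T7 \<ominus> X \<otimes> z)"
proof -
  have dz: "\<partial> z \<in> gr A 4"
    using dif_gr[OF z] by simp
  note closed = in_carrier z[THEN gr_closed] dz[THEN gr_closed]
  note product_rules = leibniz_even[OF in_gr(1)] leibniz_even[OF in_gr(2)]
  note commutation = comm_even[OF in_gr(1) in_gr(2), simplified]
  show ?thesis
    by (unfold_locales, simp_all add: in_gr_intros z dz,
        simp_all add: alg_simps dif_add dif_uminus dif_eqs dif_dif closed product_rules commutation)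
qed

end

section \<open>The obstruction, formulated with homogeneous boundaries, and its behaviour under
  changes by exact terms\<close>

definition boundaries :: "'b dg_alg \<Rightarrow> int \<Rightarrow> 'b set" where
  "boundaries A n = dif A ` gr A (n - 1)"

text \<open>In cohomology: the product of the classes of \<alpha> and \<gamma> is nonzero in
  \<open>H^6\<close>, and multiplication by these two classes gives an injective map from
  \<open>H^3\<close> to two copies of \<open>H^6\<close>. The formulation on cochains avoids
  computing with cosets.\<close>

definition pairing_nondegenerate :: "'b dg_alg \<Rightarrow> 'b \<Rightarrow> 'b \<Rightarrow> bool" where
  "pairing_nondegenerate A \<alpha> \<gamma> \<longleftrightarrow> \<alpha> \<otimes>\<^bsub>A\<^esub> \<gamma> \<notin> boundaries A 6 \<and>
    (\<forall>u\<in>gr A 3. \<partial>\<^bsub>A\<^esub> u = \<zero>\<^bsub>A\<^esub> \<longrightarrow> u \<otimes>\<^bsub>A\<^esub> \<alpha> \<in> boundaries A 6 \<longrightarrow> u \<otimes>\<^bsub>A\<^esub> \<gamma> \<in> boundaries A 6 \<longrightarrow>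
      u \<in> boundaries A 3)"

text \<open>The vanishing of \<open>H^4\<close> controls \<open>e\<close>, \<open>f\<close>,
  \<open>s\<close> and \<open>r\<close>, each of which is determined by its differential only up to
  a cocycle of degree 4.\<close>

definition massey_obstructed :: "'b dg_alg \<Rightarrow> bool" where
  "massey_obstructed A \<longleftrightarrow> (\<forall>u\<in>gr A 4. \<partial>\<^bsub>A\<^esub> u = \<zero>\<^bsub>A\<^esub> \<longrightarrow> u \<in> boundaries A 4) \<and>
    (\<exists>X Y a b c e f \<alpha> \<gamma> s r T1 T4 T7. massey A X Y a b c e f \<alpha> \<gamma> s r T1 T4 T7 \<and>
      pairing_nondegenerate A \<alpha> \<gamma>)"

context cdga
begin

lemma boundariesI: "z \<in> gr A (n - 1) \<Longrightarrow> \<partial> z \<in> boundaries A n"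
  by (simp add: boundaries_def)

lemma boundaries_add:
  assumes "x \<in> boundaries A n" "y \<in> boundaries A n"
  shows "x \<oplus> y \<in> boundaries A n"
proof -
  obtain v w where "v \<in> gr A (n - 1)" "w \<in> gr A (n - 1)" "x = \<partial> v" "y = \<partial> w"
    using assms by (auto simp: boundaries_def)
  then show ?thesis
    using boundariesI[OF gr_add[of v "n - 1" w]] by (simp add: dif_add gr_closed)
qed

lemma boundaries_minus:
  assumes "x \<in> boundaries A n"
  shows "\<ominus> x \<in> boundaries A n"
proof -
  obtain v where "v \<in> gr A (n - 1)" "x = \<partial> v"
    using assms by (auto simp: boundaries_def)
  then show ?thesis
    using boundariesI[OF gr_minus[of v "n - 1"]] by (simp add: dif_uminus gr_closed)
qed

lemma boundaries_closed: "x \<in> boundaries A n \<Longrightarrow> x \<in> carrier A"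
  using dif_closed gr_closed by (auto simp: boundaries_def)

lemma boundaries_add_iff:
  assumes "x \<in> carrier A" "y \<in> boundaries A n"
  shows "x \<oplus> y \<in> boundaries A n \<longleftrightarrow> x \<in> boundaries A n"
proof
  assume sum: "x \<oplus> y \<in> boundaries A n"
  have "x \<oplus> y \<oplus> \<ominus> y \<in> boundaries A n"
    by (rule boundaries_add[OF sum boundaries_minus[OF assms(2)]])
  moreover have "x \<oplus> y \<oplus> \<ominus> y = x"
    using assms(1) boundaries_closed[OF assms(2)] by (simp add: alg_simps)
  ultimately show "x \<in> boundaries A n"
    by simp
qed (simp add: boundaries_add assms(2))

text \<open>Classes in \<open>cohomology\<close> are cosets of the image of the whole carrier, while
  \<open>boundaries\<close> asks for a homogeneous primitive. As \<open>y\<close> is homogeneous,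
  the component of degree \<open>n - 1\<close> of any primitive is again a primitive.\<close>

lemma boundaries_if_boundary:
  assumes "y \<in> gr A n" "y = \<partial> z" "z \<in> carrier A"
  shows "y \<in> boundaries A n"
proof -
  have "y = graded_group.component A (gr A) n y"
    using graded_group.component_homogeneous[OF graded_group assms(1)] by simp
  also have "\<dots> = \<partial> (graded_group.component A (gr A) (n - 1) z)"
    using component_additive_map[OF graded_group graded_group, of "dif A" 1 z "n - 1"] assms(2,3)
    by (simp add: dif_closed dif_add dif_gr)
  finally show ?thesis
    using graded_group.component_in[OF graded_group assms(3)] by (simp add: boundaries_def)
qed

lemma boundary_mult_cocycle:
  assumes "z \<in> gr A 2" "\<gamma> \<in> gr A 3" "\<partial> \<gamma> = \<zero>"
  shows "\<partial> z \<otimes> \<gamma> \<in> boundaries A 6"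
proof -
  have "z \<otimes> \<gamma> \<in> gr A 5"
    using mult_gr[OF assms(1,2)] by simp
  moreover have "\<partial> (z \<otimes> \<gamma>) = \<partial> z \<otimes> \<gamma>"
    using leibniz_even[OF assms(1)] assms(1,2)[THEN gr_closed] assms(3)
    by (simp add: alg_simps dif_closed)
  ultimately show ?thesis
    using boundariesI[of "z \<otimes> \<gamma>" 6] by simp
qed

lemma cocycle_mult_cocycle:
  assumes "u \<in> gr A 3" "v \<in> gr A 3" "\<partial> u = \<zero>" "\<partial> v = \<zero>"
  shows "\<partial> (u \<otimes> v) = \<zero>" "u \<otimes> v \<in> gr A 6"
  using leibniz_odd[OF assms(1)] assms(1,2)[THEN gr_closed] assms(3,4) mult_gr[OF assms(1,2)]
  by (simp_all add: alg_simps)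

text \<open>The product of \<open>\<partial> z\<close> with a cocycle, on either side, is a
  boundary, so every product occurring in the condition changes by a boundary only. The analogous
  change of \<gamma> is obtained from this one through
  \<open>pairing_nondegenerate_swap\<close>.\<close>

lemma pairing_nondegenerate_move_left:
  assumes "pairing_nondegenerate A \<alpha> \<gamma>" and in_gr: "\<alpha> \<in> gr A 3" "\<gamma> \<in> gr A 3" "z \<in> gr A 2"
    and "\<partial> \<gamma> = \<zero>"
  shows "pairing_nondegenerate A (\<alpha> \<oplus> \<partial> z) \<gamma>"
proof -
  note closed = in_gr[THEN gr_closed]
  have "\<partial> z \<otimes> \<gamma> \<in> boundaries A 6"
    using boundary_mult_cocycle in_gr assms(5) by blast
  then have 1: "(\<alpha> \<oplus> \<partial> z) \<otimes> \<gamma> \<in> boundaries A 6 \<longleftrightarrow> \<alpha> \<otimes> \<gamma> \<in> boundaries A 6"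
    using boundaries_add_iff closed by (simp add: alg_simps(1-9,11-13,23-27) dif_closed)
  have 2: "u \<otimes> (\<alpha> \<oplus> \<partial> z) \<in> boundaries A 6 \<longleftrightarrow> u \<otimes> \<alpha> \<in> boundaries A 6"
    if u: "u \<in> gr A 3" "\<partial> u = \<zero>" for u
  proof -
    have "u \<otimes> z \<in> gr A 5"
      using mult_gr[OF u(1) in_gr(3)] by simp
    then have "\<ominus> (u \<otimes> \<partial> z) \<in> boundaries A 6"
      using boundariesI[of "u \<otimes> z" 6] leibniz_odd[OF u(1)] closed u(2)
      by (simp add: alg_simps dif_closed gr_closed[OF u(1)])
    from boundaries_minus[OF this] have "u \<otimes> \<partial> z \<in> boundaries A 6"
      using closed by (simp add: alg_simps dif_closed gr_closed[OF u(1)])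
    then show ?thesis
      using boundaries_add_iff closed gr_closed[OF u(1)]
      by (simp add: alg_simps(1-9,11-13,23-27) dif_closed)
  qed
  show ?thesis
    using assms(1) 1 2 unfolding pairing_nondegenerate_def by blast
qed

lemma pairing_nondegenerate_swap:
  assumes "pairing_nondegenerate A \<alpha> \<gamma>" "\<alpha> \<in> gr A 3" "\<gamma> \<in> gr A 3"
  shows "pairing_nondegenerate A \<gamma> \<alpha>"
proof -
  have "\<alpha> \<otimes> \<gamma> = \<ominus> (\<gamma> \<otimes> \<alpha>)"
    using comm_odd(1)[OF assms(3,2)] by simp
  then show ?thesis
    using assms(1) boundaries_minus[of "\<gamma> \<otimes> \<alpha>" 6] unfolding pairing_nondegenerate_def by auto
qed

lemma not_massey_obstructed_if_dif_zero:
  assumes zero: "\<And>x. x \<in> carrier A \<Longrightarrow> \<partial> x = \<zero>"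
  shows "\<not> massey_obstructed A"
proof
  assume obstructed: "massey_obstructed A"
  then obtain X Y a b c e f \<alpha> \<gamma> s r T1 T4 T7 where "massey A X Y a b c e f \<alpha> \<gamma> s r T1 T4 T7"
    and nondegenerate: "pairing_nondegenerate A \<alpha> \<gamma>"
    unfolding massey_obstructed_def by blast
  then interpret massey A X Y a b c e f \<alpha> \<gamma> s r T1 T4 T7
    by simp
  have boundaries_zero: "boundaries A n = {\<zero>}" for n
    using gr_zero[of "n - 1"] zero gr_closed by (force simp: boundaries_def)
  have "u = \<zero>" if "u \<in> gr A 4" for u
    using obstructed that zero[OF gr_closed[OF that]]
    unfolding massey_obstructed_def boundaries_zero by blast
  then have zero4: "e = \<zero>" "f = \<zero>" "s = \<zero>" "r = \<zero>"
    using in_gr by auto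
  note simps = in_carrier alg_simps
  have "a \<otimes> \<alpha> \<ominus> X \<otimes> s = \<zero>" "a \<otimes> \<gamma> \<ominus> X \<otimes> r = \<zero>"
    using dif_eqs(13,14) zero[of T4] zero[of T7] in_carrier by metis+
  then have "a \<otimes> \<alpha> = \<zero>" "a \<otimes> \<gamma> = \<zero>"
    unfolding zero4 by (simp_all add: simps)
  then have a0: "a = \<zero>"
    using nondegenerate in_gr(3) zero[of a] in_carrier
    unfolding pairing_nondegenerate_def boundaries_zero by blast
  have "Y \<otimes> e \<oplus> a \<otimes> c \<oplus> X \<otimes> f \<ominus> \<alpha> \<otimes> \<gamma> = \<zero>"
    using dif_eqs(12) zero[of T1] in_carrier by metis
  then have "\<ominus> (\<alpha> \<otimes> \<gamma>) = \<zero>"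
    unfolding zero4 a0 by (simp add: simps)
  then have "\<ominus> (\<ominus> (\<alpha> \<otimes> \<gamma>)) = \<zero>"
    by (simp only: alg_simps(21))
  then have "\<alpha> \<otimes> \<gamma> = \<zero>"
    by (simp add: simps)
  then show False
    using nondegenerate unfolding pairing_nondegenerate_def boundaries_zero by blast
qed

end

section \<open>Invariance under quasi-isomorphism\<close>

text \<open>Passing to \<open>sub_dg_alg\<close> changes the carrier and the grading but not the
  addition, so the cosets formed inside the cocycles are the sets
  \<open>coho_class A x\<close>.\<close>

lemma cohomology_carrier: "carrier (cohomology A) = coho_class A ` cocycles A"
  by (auto simp: cohomology_def with_dif_def quot_gr_alg_def sub_dg_alg_def FactRing_def
      gr_alg.defs dg_alg.defs A_RCOSETS_def RCOSETS_def coho_class_def a_r_coset_def r_coset_def)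

lemma cohomology_dif_zero: "\<partial>\<^bsub>cohomology A\<^esub> x = \<zero>\<^bsub>cohomology A\<^esub>"
  by (simp add: cohomology_def with_dif_def quot_gr_alg_def sub_dg_alg_def FactRing_def
      gr_alg.defs dg_alg.defs)

lemma coho_class_eq: "coho_class A x = {\<partial>\<^bsub>A\<^esub> z \<oplus>\<^bsub>A\<^esub> x | z. z \<in> carrier A}"
  by (auto simp: coho_class_def coboundaries_def a_r_coset_def r_coset_def)

context cdga
begin

lemma coho_class_add_boundary:
  assumes "x \<in> carrier A" "z \<in> carrier A"
  shows "coho_class A (\<partial> z \<oplus> x) = coho_class A x"
proof -
  note simps = assms dif_closed dif_add dif_uminus alg_simps
  show ?thesis
  proof (intro equalityI subsetI)
    fix y assume "y \<in> coho_class A (\<partial> z \<oplus> x)"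
    then obtain w where w: "w \<in> carrier A" "y = \<partial> w \<oplus> (\<partial> z \<oplus> x)"
      by (auto simp: coho_class_eq)
    have "y = \<partial> (w \<oplus> z) \<oplus> x"
      using w(1) unfolding w(2) by (simp add: simps)
    then show "y \<in> coho_class A x"
      using w(1) assms(2) by (auto simp: coho_class_eq alg_simps(1))
  next
    fix y assume "y \<in> coho_class A x"
    then obtain w where w: "w \<in> carrier A" "y = \<partial> w \<oplus> x"
      by (auto simp: coho_class_eq)
    have "y = \<partial> (w \<ominus> z) \<oplus> (\<partial> z \<oplus> x)"
      using w(1) unfolding w(2) by (simp add: simps)
    then show "y \<in> coho_class A (\<partial> z \<oplus> x)"
      using w(1) assms(2) by (auto simp: coho_class_eq alg_simps(4))
  qed
qed

lemma coho_class_eqD: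
  assumes "x \<in> carrier A" "y \<in> carrier A" "coho_class A x = coho_class A y"
  obtains z where "z \<in> carrier A" "x = \<partial> z \<oplus> y"
proof -
  have "\<partial> \<zero> \<oplus> x \<in> coho_class A x"
    unfolding coho_class_eq using alg_simps(2) by blast
  then have "x \<in> coho_class A y"
    using assms by (simp add: dif_zero alg_simps)
  then show thesis
    using that by (auto simp: coho_class_eq)
qed

end

locale quasi_isomorphism = C: cdga C + D: cdga D
  for C :: "'b dg_alg" and D :: "'c dg_alg" +
  fixes \<phi> :: "'b \<Rightarrow> 'c"
  assumes quasi_iso: "quasi_iso C D \<phi>"
begin

lemma hom: "\<phi> \<in> cdga_hom C D"
  using quasi_iso by (simp add: quasi_iso_def)

lemma map_closed: "x \<in> carrier C \<Longrightarrow> \<phi> x \<in> carrier D"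
  using hom by (auto simp: cdga_hom_def ring_hom_def)

lemma map_add: "x \<in> carrier C \<Longrightarrow> y \<in> carrier C \<Longrightarrow> \<phi> (x \<oplus>\<^bsub>C\<^esub> y) = \<phi> x \<oplus>\<^bsub>D\<^esub> \<phi> y"
  using hom by (auto simp: cdga_hom_def ring_hom_def)

lemma map_mult: "x \<in> carrier C \<Longrightarrow> y \<in> carrier C \<Longrightarrow> \<phi> (x \<otimes>\<^bsub>C\<^esub> y) = \<phi> x \<otimes>\<^bsub>D\<^esub> \<phi> y"
  using hom by (auto simp: cdga_hom_def ring_hom_def)

lemma map_gr: "x \<in> gr C n \<Longrightarrow> \<phi> x \<in> gr D n"
  using hom by (auto simp: cdga_hom_def image_subset_iff)

lemma map_dif: "x \<in> carrier C \<Longrightarrow> \<phi> (\<partial>\<^bsub>C\<^esub> x) = \<partial>\<^bsub>D\<^esub> (\<phi> x)"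
  using hom by (auto simp: cdga_hom_def)

lemma map_zero: "\<phi> \<zero>\<^bsub>C\<^esub> = \<zero>\<^bsub>D\<^esub>"
  using additive_zero[OF C.abelian_A D.abelian_A, of \<phi>] map_closed map_add by blast

lemma map_minus:
  assumes "x \<in> carrier C" "y \<in> carrier C"
  shows "\<phi> (x \<ominus>\<^bsub>C\<^esub> y) = \<phi> x \<ominus>\<^bsub>D\<^esub> \<phi> y"
proof -
  have "\<phi> (\<ominus>\<^bsub>C\<^esub> y) \<oplus>\<^bsub>D\<^esub> \<phi> y = \<zero>\<^bsub>D\<^esub>"
    using map_add[of "\<ominus>\<^bsub>C\<^esub> y" y] assms by (simp add: C.alg_simps map_zero)
  then have "\<phi> (\<ominus>\<^bsub>C\<^esub> y) = \<ominus>\<^bsub>D\<^esub> \<phi> y"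
    using abelian_group.minus_equality[OF D.abelian_A, of "\<phi> (\<ominus>\<^bsub>C\<^esub> y)" "\<phi> y"] assms
    by (simp add: map_closed C.alg_simps(3))
  then show ?thesis
    using assms by (simp add: a_minus_def map_add C.alg_simps(3))
qed

text \<open>\<open>coho_map\<close> unites the classes of the images of all representatives. These
  classes coincide, because \<phi> maps boundaries to boundaries, and the union collapses to one of
  them because a coset is non-empty.\<close>

lemma coho_map_class:
  assumes "x \<in> cocycles C"
  shows "coho_map D \<phi> (coho_class C x) = coho_class D (\<phi> x)"
proof -
  have x: "x \<in> carrier C"
    using assms by (simp add: cocycles_def)
  have "coho_class D (\<phi> y) = coho_class D (\<phi> x)" if y: "y \<in> coho_class C x" for y
  proof -
    obtain z where z: "z \<in> carrier C" "y = \<partial>\<^bsub>C\<^esub> z \<oplus>\<^bsub>C\<^esub> x"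
      using y by (auto simp: coho_class_eq)
    then show ?thesis
      using x by (simp add: map_add map_dif C.dif_closed D.coho_class_add_boundary map_closed)
  qed
  moreover have "coho_class C x \<noteq> {}"
    using C.alg_simps(2) by (auto simp: coho_class_eq)
  ultimately show ?thesis
    by (auto simp: coho_map_def)
qed

lemma bij: "bij_betw (coho_map D \<phi>) (coho_class C ` cocycles C) (coho_class D ` cocycles D)"
  using quasi_iso by (simp add: quasi_iso_def cohomology_carrier)

text \<open>This is injectivity in cohomology. It produces a primitive of possibly mixed degree,
  from which \<open>boundaries_if_boundary\<close> extracts a homogeneous one.\<close>

lemma boundary_reflect:
  assumes x: "x \<in> gr C n" "\<partial>\<^bsub>C\<^esub> x = \<zero>\<^bsub>C\<^esub>" and "\<phi> x \<in> boundaries D n"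
  shows "x \<in> boundaries C n"
proof -
  obtain z where z: "z \<in> carrier D" "\<phi> x = \<partial>\<^bsub>D\<^esub> z"
    using assms(3) D.gr_closed by (auto simp: boundaries_def)
  have x_closed: "x \<in> carrier C"
    using x(1) by (rule C.gr_closed)
  have cocycles: "x \<in> cocycles C" "\<zero>\<^bsub>C\<^esub> \<in> cocycles C"
    using x x_closed C.dif_zero C.alg_simps(2) by (auto simp: cocycles_def)
  have "\<partial>\<^bsub>D\<^esub> z \<oplus>\<^bsub>D\<^esub> \<zero>\<^bsub>D\<^esub> = \<phi> x"
    using z D.dif_closed[OF z(1)] by (simp add: D.alg_simps)
  then have "coho_class D (\<phi> x) = coho_class D (\<phi> \<zero>\<^bsub>C\<^esub>)"
    using D.coho_class_add_boundary[OF D.alg_simps(2) z(1)] by (simp only: map_zero)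
  then have "coho_map D \<phi> (coho_class C x) = coho_map D \<phi> (coho_class C \<zero>\<^bsub>C\<^esub>)"
    by (simp only: coho_map_class[OF cocycles(1)] coho_map_class[OF cocycles(2)])
  then have "coho_class C x = coho_class C \<zero>\<^bsub>C\<^esub>"
    using inj_onD[OF bij_betw_imp_inj_on[OF bij]] cocycles by blast
  then obtain w where "w \<in> carrier C" "x = \<partial>\<^bsub>C\<^esub> w \<oplus>\<^bsub>C\<^esub> \<zero>\<^bsub>C\<^esub>"
    by (rule C.coho_class_eqD[OF x_closed C.alg_simps(2)])
  then show ?thesis
    by (intro C.boundaries_if_boundary[OF x(1), of w]) (simp_all add: C.dif_closed C.alg_simps)
qed

lemma map_boundaries: "x \<in> boundaries C n \<Longrightarrow> \<phi> x \<in> boundaries D n"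
  using map_gr map_dif C.gr_closed by (auto simp: boundaries_def)

text \<open>This is surjectivity in cohomology. It produces a cocycle \<open>x\<close> of possibly
  mixed degree whose image is \<open>y\<close> up to some \<open>\<partial> z\<close>; since
  \<open>\<partial>\<close> and \<phi> are compatible with components, the parts of \<open>x\<close>
  in degree \<open>n\<close> and of \<open>z\<close> in degree \<open>n - 1\<close> do the
  same.\<close>

lemma cocycle_lift:
  assumes y: "y \<in> gr D n" "\<partial>\<^bsub>D\<^esub> y = \<zero>\<^bsub>D\<^esub>"
  obtains x z where "x \<in> gr C n" "\<partial>\<^bsub>C\<^esub> x = \<zero>\<^bsub>C\<^esub>" "z \<in> gr D (n - 1)" "\<phi> x = y \<oplus>\<^bsub>D\<^esub> \<partial>\<^bsub>D\<^esub> z"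
proof -
  have y_closed: "y \<in> carrier D"
    using y(1) by (rule D.gr_closed)
  have "y \<in> cocycles D"
    using y y_closed by (simp add: cocycles_def)
  then have "coho_class D y \<in> coho_map D \<phi> ` coho_class C ` cocycles C"
    using bij_betw_imp_surj_on[OF bij] by blast
  then obtain x where x: "x \<in> carrier C" "\<partial>\<^bsub>C\<^esub> x = \<zero>\<^bsub>C\<^esub>" "coho_class D (\<phi> x) = coho_class D y"
    using coho_map_class by (auto simp: cocycles_def)
  obtain z where z: "z \<in> carrier D" "\<phi> x = \<partial>\<^bsub>D\<^esub> z \<oplus>\<^bsub>D\<^esub> y"
    by (rule D.coho_class_eqD[OF map_closed[OF x(1)] y_closed x(3)])
  let ?c = "\<lambda>k. graded_group.component C (gr C) k"
  let ?d = "\<lambda>k. graded_group.component D (gr D) k"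
  have "\<phi> (?c n x) = ?d n (\<phi> x)"
    using component_additive_map[OF C.graded_group D.graded_group, of \<phi> 0 x n] x(1)
    by (simp add: map_closed map_add map_gr)
  also have "\<dots> = ?d n (\<partial>\<^bsub>D\<^esub> z) \<oplus>\<^bsub>D\<^esub> ?d n y"
    unfolding z(2) using graded_group.component_add[OF D.graded_group] z(1) y_closed D.dif_closed
    by blast
  also have "?d n y = y"
    using graded_group.component_homogeneous[OF D.graded_group y(1)] .
  also have "?d n (\<partial>\<^bsub>D\<^esub> z) = \<partial>\<^bsub>D\<^esub> (?d (n - 1) z)"
    using component_additive_map[OF D.graded_group D.graded_group, of "dif D" 1 z "n - 1"] z(1)
    by (simp add: D.dif_closed D.dif_add D.dif_gr)
  finally have eq: "\<phi> (?c n x) = \<partial>\<^bsub>D\<^esub> (?d (n - 1) z) \<oplus>\<^bsub>D\<^esub> y" .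
  have in_gr: "?d (n - 1) z \<in> gr D (n - 1)" "?c n x \<in> gr C n"
    using graded_group.component_in[OF D.graded_group z(1)]
        graded_group.component_in[OF C.graded_group x(1)]
    by blast+
  have "\<partial>\<^bsub>C\<^esub> (?c n x) = ?c (n + 1) (\<partial>\<^bsub>C\<^esub> x)"
    using component_additive_map[OF C.graded_group C.graded_group, of "dif C" 1 x n] x(1)
    by (simp add: C.dif_closed C.dif_add C.dif_gr)
  also have "\<dots> = \<zero>\<^bsub>C\<^esub>"
    unfolding x(2) using graded_group.component_homogeneous[OF C.graded_group C.gr_zero] .
  finally have "\<partial>\<^bsub>C\<^esub> (?c n x) = \<zero>\<^bsub>C\<^esub>" .
  moreover have "\<phi> (?c n x) = y \<oplus>\<^bsub>D\<^esub> \<partial>\<^bsub>D\<^esub> (?d (n - 1) z)"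
    using eq D.alg_simps(10)[OF D.dif_closed[OF D.gr_closed[OF in_gr(1)]] y_closed] by simp
  ultimately show thesis
    using that[of "?c n x" "?d (n - 1) z"] in_gr by blast
qed

text \<open>One step of the usual lifting of a Sullivan algebra through a quasi-isomorphism: the
  generator has differential \<open>w\<close> in \<open>C\<close> and prescribed image
  \<open>g\<close> in \<open>D\<close>. Injectivity gives some primitive \<open>v\<close> of
  \<open>w\<close>; the error \<open>g - \<phi> v\<close> is a cocycle, and adding its lift
  \<open>u\<close> to \<open>v\<close> removes the error up to an exact term.\<close>

lemma lift:
  assumes g: "g \<in> gr D n" "\<partial>\<^bsub>D\<^esub> g = \<phi> w" and w: "w \<in> gr C (n + 1)" "\<partial>\<^bsub>C\<^esub> w = \<zero>\<^bsub>C\<^esub>"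
  obtains x z where "x \<in> gr C n" "\<partial>\<^bsub>C\<^esub> x = w" "z \<in> gr D (n - 1)" "\<phi> x = g \<oplus>\<^bsub>D\<^esub> \<partial>\<^bsub>D\<^esub> z"
proof -
  have "w \<in> boundaries C (n + 1)"
    using boundary_reflect[OF w] D.boundariesI[of g "n + 1"] g by simp
  then obtain v where v: "v \<in> gr C n" "\<partial>\<^bsub>C\<^esub> v = w"
    by (auto simp: boundaries_def)
  note closed = C.gr_closed[OF v(1)] D.gr_closed[OF g(1)] map_closed D.dif_closed C.dif_closed
  have "g \<ominus>\<^bsub>D\<^esub> \<phi> v \<in> gr D n"
    using D.gr_diff[OF g(1) map_gr[OF v(1)]] .
  moreover have "\<partial>\<^bsub>D\<^esub> (g \<ominus>\<^bsub>D\<^esub> \<phi> v) = \<zero>\<^bsub>D\<^esub>"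
    using g(2) v(2) closed map_dif[of v] by (simp add: D.alg_simps D.dif_add D.dif_uminus)
  ultimately obtain u z where u: "u \<in> gr C n" "\<partial>\<^bsub>C\<^esub> u = \<zero>\<^bsub>C\<^esub>" "z \<in> gr D (n - 1)"
      "\<phi> u = (g \<ominus>\<^bsub>D\<^esub> \<phi> v) \<oplus>\<^bsub>D\<^esub> \<partial>\<^bsub>D\<^esub> z"
    by (rule cocycle_lift)
  have closed': "u \<in> carrier C" "z \<in> carrier D" "w \<in> carrier C"
    using u w C.gr_closed D.gr_closed by blast+
  show thesis
  proof (rule that)
    show "u \<oplus>\<^bsub>C\<^esub> v \<in> gr C n"
      using C.gr_add u v by blast
    show "\<partial>\<^bsub>C\<^esub> (u \<oplus>\<^bsub>C\<^esub> v) = w"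
      using u v closed closed' by (simp add: C.dif_add C.alg_simps)
    show "\<phi> (u \<oplus>\<^bsub>C\<^esub> v) = g \<oplus>\<^bsub>D\<^esub> \<partial>\<^bsub>D\<^esub> z"
      using closed closed' D.add_diff_cancel[of "\<phi> v" "g \<oplus>\<^bsub>D\<^esub> \<partial>\<^bsub>D\<^esub> z"]
      by (simp add: u(4) map_add D.alg_simps)
  qed (fact u)
qed

end

section \<open>Transport of the obstruction along a quasi-isomorphism, in both directions\<close>

context quasi_isomorphism
begin

lemma massey_push:
  assumes "massey C X Y a b c e f \<alpha> \<gamma> s r T1 T4 T7"
  shows "massey D (\<phi> X) (\<phi> Y) (\<phi> a) (\<phi> b) (\<phi> c) (\<phi> e) (\<phi> f) (\<phi> \<alpha>) (\<phi> \<gamma>) (\<phi> s) (\<phi> r)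
    (\<phi> T1) (\<phi> T4) (\<phi> T7)"
proof -
  interpret massey C X Y a b c e f \<alpha> \<gamma> s r T1 T4 T7
    by fact
  show ?thesis
    by unfold_locales (simp_all add: map_gr in_gr in_carrier map_dif[symmetric] dif_eqs map_zero
        map_add map_minus map_mult C.alg_simps(1-5))
qed

text \<open>Surjectivity in degree 3 lifts a cocycle of \<open>D\<close> to \<open>C\<close> up to
  an exact term, which affects its products by boundaries only; injectivity in degree 6 reflects
  exactness of these products.\<close>

lemma pairing_nondegenerate_push:
  assumes nondegenerate: "pairing_nondegenerate C \<alpha> \<gamma>"
    and \<alpha>: "\<alpha> \<in> gr C 3" "\<partial>\<^bsub>C\<^esub> \<alpha> = \<zero>\<^bsub>C\<^esub>" and \<gamma>: "\<gamma> \<in> gr C 3" "\<partial>\<^bsub>C\<^esub> \<gamma> = \<zero>\<^bsub>C\<^esub>"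
  shows "pairing_nondegenerate D (\<phi> \<alpha>) (\<phi> \<gamma>)"
  unfolding pairing_nondegenerate_def
proof (intro conjI ballI impI notI)
  have reflect: "x \<otimes>\<^bsub>C\<^esub> v \<in> boundaries C 6"
    if "\<phi> (x \<otimes>\<^bsub>C\<^esub> v) \<in> boundaries D 6" "x \<in> gr C 3" "\<partial>\<^bsub>C\<^esub> x = \<zero>\<^bsub>C\<^esub>" "v \<in> gr C 3" "\<partial>\<^bsub>C\<^esub> v = \<zero>\<^bsub>C\<^esub>"
    for x v
    using boundary_reflect[of "x \<otimes>\<^bsub>C\<^esub> v" 6] C.cocycle_mult_cocycle that by blast
  show False if "\<phi> \<alpha> \<otimes>\<^bsub>D\<^esub> \<phi> \<gamma> \<in> boundaries D 6"
    using that reflect[of \<alpha> \<gamma>] \<alpha> \<gamma> nondegenerate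
    by (simp add: map_mult C.gr_closed pairing_nondegenerate_def)
  show "u \<in> boundaries D 3"
    if u: "u \<in> gr D 3" "\<partial>\<^bsub>D\<^esub> u = \<zero>\<^bsub>D\<^esub>"
      and products: "u \<otimes>\<^bsub>D\<^esub> \<phi> \<alpha> \<in> boundaries D 6" "u \<otimes>\<^bsub>D\<^esub> \<phi> \<gamma> \<in> boundaries D 6" for u
  proof -
    obtain x z where x: "x \<in> gr C 3" "\<partial>\<^bsub>C\<^esub> x = \<zero>\<^bsub>C\<^esub>" and z: "z \<in> gr D 2"
        "\<phi> x = u \<oplus>\<^bsub>D\<^esub> \<partial>\<^bsub>D\<^esub> z"
      using cocycle_lift[OF u] by auto
    have product: "x \<otimes>\<^bsub>C\<^esub> v \<in> boundaries C 6"
      if "u \<otimes>\<^bsub>D\<^esub> \<phi> v \<in> boundaries D 6" and v: "v \<in> gr C 3" "\<partial>\<^bsub>C\<^esub> v = \<zero>\<^bsub>C\<^esub>" for v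
    proof -
      have "\<partial>\<^bsub>D\<^esub> (\<phi> v) = \<zero>\<^bsub>D\<^esub>"
        using v C.gr_closed map_dif[of v] map_zero by simp
      then have "\<partial>\<^bsub>D\<^esub> z \<otimes>\<^bsub>D\<^esub> \<phi> v \<in> boundaries D 6"
        using D.boundary_mult_cocycle[OF z(1) map_gr[OF v(1)]] by simp
      moreover have "\<phi> (x \<otimes>\<^bsub>C\<^esub> v) = u \<otimes>\<^bsub>D\<^esub> \<phi> v \<oplus>\<^bsub>D\<^esub> \<partial>\<^bsub>D\<^esub> z \<otimes>\<^bsub>D\<^esub> \<phi> v"
        using C.gr_closed[OF x(1)] C.gr_closed[OF v(1)] D.gr_closed[OF u(1)] D.gr_closed[OF z(1)]
        by (simp add: map_mult z(2) map_closed D.dif_closed D.alg_simps(13))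
      ultimately have "\<phi> (x \<otimes>\<^bsub>C\<^esub> v) \<in> boundaries D 6"
        using D.boundaries_add that(1) by simp
      then show ?thesis
        using reflect x v by blast
    qed
    have "x \<in> boundaries C 3"
      using nondegenerate x product[OF products(1) \<alpha>] product[OF products(2) \<gamma>]
      unfolding pairing_nondegenerate_def by blast
    then have "u \<oplus>\<^bsub>D\<^esub> \<partial>\<^bsub>D\<^esub> z \<in> boundaries D 3"
      using map_boundaries z(2) by metis
    then show ?thesis
      using D.boundaries_add_iff[OF D.gr_closed[OF u(1)] D.boundariesI[of z 3]] z(1) by simp
  qed
qed

text \<open>Exact products are mapped to exact products, so the condition in \<open>D\<close>
  applies to \<open>\<phi> u\<close>; injectivity in degree 3 carries its conclusion back to
  \<open>u\<close>.\<close>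

lemma pairing_nondegenerate_pull:
  assumes nondegenerate: "pairing_nondegenerate D (\<phi> \<alpha>) (\<phi> \<gamma>)" and in_gr: "\<alpha> \<in> gr C 3" "\<gamma> \<in> gr C 3"
  shows "pairing_nondegenerate C \<alpha> \<gamma>"
  unfolding pairing_nondegenerate_def
proof (intro conjI ballI impI notI)
  have product: "\<phi> x \<otimes>\<^bsub>D\<^esub> \<phi> v \<in> boundaries D 6" if "x \<otimes>\<^bsub>C\<^esub> v \<in> boundaries C 6" "x \<in> gr C 3"
      "v \<in> gr C 3" for x v
    using map_boundaries[OF that(1)] C.gr_closed that(2,3) by (simp add: map_mult)
  show False if "\<alpha> \<otimes>\<^bsub>C\<^esub> \<gamma> \<in> boundaries C 6"
    using product[OF that in_gr] nondegenerate by (simp add: pairing_nondegenerate_def)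
  show "u \<in> boundaries C 3"
    if u: "u \<in> gr C 3" "\<partial>\<^bsub>C\<^esub> u = \<zero>\<^bsub>C\<^esub>"
      and products: "u \<otimes>\<^bsub>C\<^esub> \<alpha> \<in> boundaries C 6" "u \<otimes>\<^bsub>C\<^esub> \<gamma> \<in> boundaries C 6" for u
  proof (rule boundary_reflect[OF u])
    have "\<partial>\<^bsub>D\<^esub> (\<phi> u) = \<zero>\<^bsub>D\<^esub>"
      using u C.gr_closed map_dif[of u] map_zero by simp
    then show "\<phi> u \<in> boundaries D 3"
      using nondegenerate map_gr[OF u(1)] product[OF products(1) u(1) in_gr(1)]
        product[OF products(2) u(1) in_gr(2)]
      unfolding pairing_nondegenerate_def by blast
  qed
qed

lemma acyclic_push:
  assumes "\<forall>u\<in>gr C n. \<partial>\<^bsub>C\<^esub> u = \<zero>\<^bsub>C\<^esub> \<longrightarrow> u \<in> boundaries C n"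
  shows "\<forall>u\<in>gr D n. \<partial>\<^bsub>D\<^esub> u = \<zero>\<^bsub>D\<^esub> \<longrightarrow> u \<in> boundaries D n"
proof (intro ballI impI)
  fix u assume u: "u \<in> gr D n" "\<partial>\<^bsub>D\<^esub> u = \<zero>\<^bsub>D\<^esub>"
  obtain x z where "x \<in> gr C n" "\<partial>\<^bsub>C\<^esub> x = \<zero>\<^bsub>C\<^esub>" "z \<in> gr D (n - 1)" "\<phi> x = u \<oplus>\<^bsub>D\<^esub> \<partial>\<^bsub>D\<^esub> z"
    using cocycle_lift[OF u] by blast
  then show "u \<in> boundaries D n"
    using assms map_boundaries[of x n] D.boundaries_add_iff[OF D.gr_closed[OF u(1)] D.boundariesI]
    by auto
qed

lemma acyclic_pull:
  assumes "\<forall>u\<in>gr D n. \<partial>\<^bsub>D\<^esub> u = \<zero>\<^bsub>D\<^esub> \<longrightarrow> u \<in> boundaries D n"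
  shows "\<forall>u\<in>gr C n. \<partial>\<^bsub>C\<^esub> u = \<zero>\<^bsub>C\<^esub> \<longrightarrow> u \<in> boundaries C n"
proof (intro ballI impI)
  fix u assume u: "u \<in> gr C n" "\<partial>\<^bsub>C\<^esub> u = \<zero>\<^bsub>C\<^esub>"
  then have "\<partial>\<^bsub>D\<^esub> (\<phi> u) = \<zero>\<^bsub>D\<^esub>"
    using C.gr_closed map_dif[of u] map_zero by simp
  then show "u \<in> boundaries C n"
    using boundary_reflect[OF u] assms map_gr[OF u(1)] by blast
qed

lemma massey_obstructed_push:
  assumes "massey_obstructed C"
  shows "massey_obstructed D"
proof -
  obtain X Y a b c e f \<alpha> \<gamma> s r T1 T4 T7 where system: "massey C X Y a b c e f \<alpha> \<gamma> s r T1 T4 T7"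
    and nondegenerate: "pairing_nondegenerate C \<alpha> \<gamma>"
    using assms unfolding massey_obstructed_def by blast
  have "pairing_nondegenerate D (\<phi> \<alpha>) (\<phi> \<gamma>)"
    by (rule pairing_nondegenerate_push[OF nondegenerate])
        (fact massey.in_gr[OF system] massey.dif_eqs[OF system])+
  then show ?thesis
    using massey_push[OF system] acyclic_push assms unfolding massey_obstructed_def by blast
qed

text \<open>Each generator is first moved within its class in \<open>D\<close> until it lies in the image of \<open>\<phi>\<close>. The
  generators are then lifted strictly, one after the other.\<close>

lemma massey_obstructed_pull:
  assumes obstructed: "massey_obstructed D"
  shows "massey_obstructed C"
proof -
  obtain X Y a b c e f \<alpha> \<gamma> s r T1 T4 T7 where system: "massey D X Y a b c e f \<alpha> \<gamma> s r T1 T4 T7"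
    and nondegenerate: "pairing_nondegenerate D \<alpha> \<gamma>"
    using obstructed unfolding massey_obstructed_def by blast
  \<comment> \<open>The order of treatment is X, Y, \<alpha>, \<gamma>, a, b, c, e, f, s, r, and
    finally T1, T4, T7. A move alters only the moved generator and later ones, so generators that
    already lie in the image of \<phi> are never disturbed, and each differential involves only
    generators lifted before.\<close>
  obtain X0 zX where X0: "X0 \<in> gr C 2" "\<partial>\<^bsub>C\<^esub> X0 = \<zero>\<^bsub>C\<^esub>"
    and zX: "zX \<in> gr D 1" "\<phi> X0 = X \<oplus>\<^bsub>D\<^esub> \<partial>\<^bsub>D\<^esub> zX"
    using cocycle_lift[OF massey.in_gr(1)[OF system] massey.dif_eqs(1)[OF system]] by auto
  obtain a1 b1 e1 f1 s1 r1 T1_1 T4_1 T7_1 where system_X: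
      "massey D (\<phi> X0) Y a1 b1 c e1 f1 \<alpha> \<gamma> s1 r1 T1_1 T4_1 T7_1"
    using massey.move_X[OF system zX(1)] unfolding zX(2)[symmetric] by blast
  obtain Y0 zY where Y0: "Y0 \<in> gr C 2" "\<partial>\<^bsub>C\<^esub> Y0 = \<zero>\<^bsub>C\<^esub>"
    and zY: "zY \<in> gr D 1" "\<phi> Y0 = Y \<oplus>\<^bsub>D\<^esub> \<partial>\<^bsub>D\<^esub> zY"
    using cocycle_lift[OF massey.in_gr(2)[OF system_X] massey.dif_eqs(2)[OF system_X]] by auto
  obtain b2 c1 e2 f2 T1_2 where system_Y: "massey D (\<phi> X0) (\<phi> Y0) a1 b2 c1 e2 f2 \<alpha> \<gamma> s1 r1 T1_2
      T4_1 T7_1"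
    using massey.move_Y[OF system_X zY(1)] unfolding zY(2)[symmetric] by blast
  obtain \<alpha>0 zalpha where alpha0: "\<alpha>0 \<in> gr C 3" "\<partial>\<^bsub>C\<^esub> \<alpha>0 = \<zero>\<^bsub>C\<^esub>"
    and zalpha: "zalpha \<in> gr D 2" "\<phi> \<alpha>0 = \<alpha> \<oplus>\<^bsub>D\<^esub> \<partial>\<^bsub>D\<^esub> zalpha"
    using cocycle_lift[OF massey.in_gr(8)[OF system_Y] massey.dif_eqs(8)[OF system_Y]] by auto
  obtain s2 T4_2 T1_3 where system_alpha: "massey D (\<phi> X0) (\<phi> Y0) a1 b2 c1 e2 f2 (\<phi> \<alpha>0) \<gamma> s2 r1
      T1_3 T4_2 T7_1"
    using massey.move_alpha[OF system_Y zalpha(1)] unfolding zalpha(2)[symmetric] by blast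
  have nondegenerate_left: "pairing_nondegenerate D (\<phi> \<alpha>0) \<gamma>"
    using D.pairing_nondegenerate_move_left[OF nondegenerate massey.in_gr(8,9)[OF system_Y]
        zalpha(1)
      massey.dif_eqs(9)[OF system_Y]] unfolding zalpha(2) .
  obtain \<gamma>0 zgamma where gamma0: "\<gamma>0 \<in> gr C 3" "\<partial>\<^bsub>C\<^esub> \<gamma>0 = \<zero>\<^bsub>C\<^esub>"
    and zgamma: "zgamma \<in> gr D 2" "\<phi> \<gamma>0 = \<gamma> \<oplus>\<^bsub>D\<^esub> \<partial>\<^bsub>D\<^esub> zgamma"
    using cocycle_lift[OF massey.in_gr(9)[OF system_alpha] massey.dif_eqs(9)[OF system_alpha]]
    by auto
  obtain r2 T7_2 T1_4 where system_gamma: "massey D (\<phi> X0) (\<phi> Y0) a1 b2 c1 e2 f2 (\<phi> \<alpha>0) (\<phi> \<gamma>0) s2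
      r2 T1_4 T4_2 T7_2"
    using massey.move_gamma[OF system_alpha zgamma(1)] unfolding zgamma(2)[symmetric] by blast
  have "pairing_nondegenerate D (\<phi> \<gamma>0) (\<phi> \<alpha>0)"
    using D.pairing_nondegenerate_move_left[OF
        D.pairing_nondegenerate_swap[OF nondegenerate_left massey.in_gr(8,9)[OF system_alpha]]
        massey.in_gr(9,8)[OF system_alpha] zgamma(1) massey.dif_eqs(8)[OF system_alpha]]
    unfolding zgamma(2) .
  then have nondegenerate0: "pairing_nondegenerate C \<alpha>0 \<gamma>0"
    using D.pairing_nondegenerate_swap map_gr alpha0 gamma0 pairing_nondegenerate_pull by blast
  note map_rules = map_mult map_add map_minus C.alg_simps(1,4,5) C.gr_closed[OF X0(1)]
      C.gr_closed[OF Y0(1)] C.gr_closed[OF alpha0(1)] C.gr_closed[OF gamma0(1)]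
  note rules = C.comm_even[OF X0(1) Y0(1), simplified] C.alg_simps
    C.dif_closed C.dif_add C.dif_uminus
    C.gr_closed[OF X0(1)] C.leibniz_even[OF X0(1)] X0(2)
    C.gr_closed[OF Y0(1)] C.leibniz_even[OF Y0(1)] Y0(2)
    C.gr_closed[OF alpha0(1)] C.leibniz_odd[OF alpha0(1)] alpha0(2)
    C.gr_closed[OF gamma0(1)] C.leibniz_odd[OF gamma0(1)] gamma0(2)
  note degrees = C.mult_low_degree C.gr_add C.gr_diff X0(1) Y0(1) alpha0(1) gamma0(1)
  \<comment> \<open>The pattern repeated below: the differential prescribed for the next generator
    is formed from the lifts chosen so far. It has the right degree, is a cocycle, and maps to the
    differential of the current generator in \<open>D\<close>; these are the premises of
    \<open>lift\<close>.\<close>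
  have wa: "X0 \<otimes>\<^bsub>C\<^esub> X0 \<in> gr C 4" "\<partial>\<^bsub>C\<^esub> (X0 \<otimes>\<^bsub>C\<^esub> X0) = \<zero>\<^bsub>C\<^esub>"
    "\<phi> (X0 \<otimes>\<^bsub>C\<^esub> X0) = \<partial>\<^bsub>D\<^esub> a1"
    by (simp add: degrees, simp add: rules, simp add: map_rules massey.dif_eqs[OF system_gamma])
  obtain a0 za where a0: "a0 \<in> gr C 3" "\<partial>\<^bsub>C\<^esub> a0 = X0 \<otimes>\<^bsub>C\<^esub> X0"
    and za: "za \<in> gr D 2" "\<phi> a0 = a1 \<oplus>\<^bsub>D\<^esub> \<partial>\<^bsub>D\<^esub> za"
    using lift[OF massey.in_gr(3)[OF system_gamma] wa(3)[symmetric] _ wa(2)] wa(1) by auto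
  obtain e3 T1_5 T4_3 T7_3 where system_a: "massey D (\<phi> X0) (\<phi> Y0) (\<phi> a0) b2 c1 e3 f2 (\<phi> \<alpha>0)
      (\<phi> \<gamma>0) s2 r2 T1_5 T4_3 T7_3"
    using massey.move_a[OF system_gamma za(1)] unfolding za(2)[symmetric] by blast
  note map_rules = map_rules C.gr_closed[OF a0(1)]
  \<comment> \<open>The commutation of \<open>Y0\<close> with \<open>a0\<close> serves the cocycle
    condition for \<open>T1\<close>, where \<open>Y Y a\<close> from \<open>Y e\<close> has to
    cancel against \<open>a Y Y\<close> from \<open>a c\<close>.\<close>
  note rules = rules
    C.gr_closed[OF a0(1)] C.leibniz_odd[OF a0(1)] a0(2)
    C.comm_even[OF Y0(1) a0(1), simplified]
  note degrees = degrees a0(1)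
  have wb: "X0 \<otimes>\<^bsub>C\<^esub> Y0 \<in> gr C 4" "\<partial>\<^bsub>C\<^esub> (X0 \<otimes>\<^bsub>C\<^esub> Y0) = \<zero>\<^bsub>C\<^esub>"
    "\<phi> (X0 \<otimes>\<^bsub>C\<^esub> Y0) = \<partial>\<^bsub>D\<^esub> b2"
    by (simp add: degrees, simp add: rules, simp add: map_rules massey.dif_eqs[OF system_a])
  obtain b0 zb where b0: "b0 \<in> gr C 3" "\<partial>\<^bsub>C\<^esub> b0 = X0 \<otimes>\<^bsub>C\<^esub> Y0"
    and zb: "zb \<in> gr D 2" "\<phi> b0 = b2 \<oplus>\<^bsub>D\<^esub> \<partial>\<^bsub>D\<^esub> zb"
    using lift[OF massey.in_gr(4)[OF system_a] wb(3)[symmetric] _ wb(2)] wb(1) by auto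
  obtain e4 f3 where system_b: "massey D (\<phi> X0) (\<phi> Y0) (\<phi> a0) (\<phi> b0) c1 e4 f3 (\<phi> \<alpha>0) (\<phi> \<gamma>0) s2 r2
      T1_5 T4_3 T7_3"
    using massey.move_b[OF system_a zb(1)] unfolding zb(2)[symmetric] by blast
  note map_rules = map_rules C.gr_closed[OF b0(1)]
  note rules = rules
    C.gr_closed[OF b0(1)] C.leibniz_odd[OF b0(1)] b0(2)
  note degrees = degrees b0(1)
  have wc: "Y0 \<otimes>\<^bsub>C\<^esub> Y0 \<in> gr C 4" "\<partial>\<^bsub>C\<^esub> (Y0 \<otimes>\<^bsub>C\<^esub> Y0) = \<zero>\<^bsub>C\<^esub>"
    "\<phi> (Y0 \<otimes>\<^bsub>C\<^esub> Y0) = \<partial>\<^bsub>D\<^esub> c1"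
    by (simp add: degrees, simp add: rules, simp add: map_rules massey.dif_eqs[OF system_b])
  obtain c0 zc where c0: "c0 \<in> gr C 3" "\<partial>\<^bsub>C\<^esub> c0 = Y0 \<otimes>\<^bsub>C\<^esub> Y0"
    and zc: "zc \<in> gr D 2" "\<phi> c0 = c1 \<oplus>\<^bsub>D\<^esub> \<partial>\<^bsub>D\<^esub> zc"
    using lift[OF massey.in_gr(5)[OF system_b] wc(3)[symmetric] _ wc(2)] wc(1) by auto
  obtain f4 T1_6 where system_c: "massey D (\<phi> X0) (\<phi> Y0) (\<phi> a0) (\<phi> b0) (\<phi> c0) e4 f4 (\<phi> \<alpha>0) (\<phi> \<gamma>0)
      s2 r2 T1_6 T4_3 T7_3"
    using massey.move_c[OF system_b zc(1)] unfolding zc(2)[symmetric] by blast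
  note map_rules = map_rules C.gr_closed[OF c0(1)]
  note rules = rules
    C.gr_closed[OF c0(1)] C.leibniz_odd[OF c0(1)] c0(2)
  note degrees = degrees c0(1)
  have we: "Y0 \<otimes>\<^bsub>C\<^esub> a0 \<ominus>\<^bsub>C\<^esub> X0 \<otimes>\<^bsub>C\<^esub> b0 \<in> gr C 5" "\<partial>\<^bsub>C\<^esub> (Y0 \<otimes>\<^bsub>C\<^esub> a0 \<ominus>\<^bsub>C\<^esub> X0 \<otimes>\<^bsub>C\<^esub> b0) = \<zero>\<^bsub>C\<^esub>"
    "\<phi> (Y0 \<otimes>\<^bsub>C\<^esub> a0 \<ominus>\<^bsub>C\<^esub> X0 \<otimes>\<^bsub>C\<^esub> b0) = \<partial>\<^bsub>D\<^esub> e4"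
    by (simp add: degrees, simp add: rules, simp add: map_rules massey.dif_eqs[OF system_c])
  obtain e0 ze where e0: "e0 \<in> gr C 4" "\<partial>\<^bsub>C\<^esub> e0 = Y0 \<otimes>\<^bsub>C\<^esub> a0 \<ominus>\<^bsub>C\<^esub> X0 \<otimes>\<^bsub>C\<^esub> b0"
    and ze: "ze \<in> gr D 3" "\<phi> e0 = e4 \<oplus>\<^bsub>D\<^esub> \<partial>\<^bsub>D\<^esub> ze"
    using lift[OF massey.in_gr(6)[OF system_c] we(3)[symmetric] _ we(2)] we(1) by auto
  obtain T1_7 where system_e: "massey D (\<phi> X0) (\<phi> Y0) (\<phi> a0) (\<phi> b0) (\<phi> c0) (\<phi> e0) f4 (\<phi> \<alpha>0) (\<phi> \<gamma>0)
      s2 r2 T1_7 T4_3 T7_3"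
    using massey.move_e[OF system_c ze(1)] unfolding ze(2)[symmetric] by blast
  note map_rules = map_rules C.gr_closed[OF e0(1)]
  note rules = rules
    C.gr_closed[OF e0(1)] C.leibniz_even[OF e0(1)] e0(2)
  note degrees = degrees e0(1)
  have wf: "Y0 \<otimes>\<^bsub>C\<^esub> b0 \<ominus>\<^bsub>C\<^esub> X0 \<otimes>\<^bsub>C\<^esub> c0 \<in> gr C 5" "\<partial>\<^bsub>C\<^esub> (Y0 \<otimes>\<^bsub>C\<^esub> b0 \<ominus>\<^bsub>C\<^esub> X0 \<otimes>\<^bsub>C\<^esub> c0) = \<zero>\<^bsub>C\<^esub>"
    "\<phi> (Y0 \<otimes>\<^bsub>C\<^esub> b0 \<ominus>\<^bsub>C\<^esub> X0 \<otimes>\<^bsub>C\<^esub> c0) = \<partial>\<^bsub>D\<^esub> f4"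
    by (simp add: degrees, simp add: rules, simp add: map_rules massey.dif_eqs[OF system_e])
  obtain f0 zf where f0: "f0 \<in> gr C 4" "\<partial>\<^bsub>C\<^esub> f0 = Y0 \<otimes>\<^bsub>C\<^esub> b0 \<ominus>\<^bsub>C\<^esub> X0 \<otimes>\<^bsub>C\<^esub> c0"
    and zf: "zf \<in> gr D 3" "\<phi> f0 = f4 \<oplus>\<^bsub>D\<^esub> \<partial>\<^bsub>D\<^esub> zf"
    using lift[OF massey.in_gr(7)[OF system_e] wf(3)[symmetric] _ wf(2)] wf(1) by auto
  obtain T1_8 where system_f: "massey D (\<phi> X0) (\<phi> Y0) (\<phi> a0) (\<phi> b0) (\<phi> c0) (\<phi> e0) (\<phi> f0) (\<phi> \<alpha>0)
      (\<phi> \<gamma>0) s2 r2 T1_8 T4_3 T7_3"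
    using massey.move_f[OF system_e zf(1)] unfolding zf(2)[symmetric] by blast
  note map_rules = map_rules C.gr_closed[OF f0(1)]
  note rules = rules
    C.gr_closed[OF f0(1)] C.leibniz_even[OF f0(1)] f0(2)
  note degrees = degrees f0(1)
  have ws: "X0 \<otimes>\<^bsub>C\<^esub> \<alpha>0 \<in> gr C 5" "\<partial>\<^bsub>C\<^esub> (X0 \<otimes>\<^bsub>C\<^esub> \<alpha>0) = \<zero>\<^bsub>C\<^esub>"
    "\<phi> (X0 \<otimes>\<^bsub>C\<^esub> \<alpha>0) = \<partial>\<^bsub>D\<^esub> s2"
    by (simp add: degrees, simp add: rules, simp add: map_rules massey.dif_eqs[OF system_f])
  obtain s0 zs where s0: "s0 \<in> gr C 4" "\<partial>\<^bsub>C\<^esub> s0 = X0 \<otimes>\<^bsub>C\<^esub> \<alpha>0"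
    and zs: "zs \<in> gr D 3" "\<phi> s0 = s2 \<oplus>\<^bsub>D\<^esub> \<partial>\<^bsub>D\<^esub> zs"
    using lift[OF massey.in_gr(10)[OF system_f] ws(3)[symmetric] _ ws(2)] ws(1) by auto
  obtain T4_4 where system_s: "massey D (\<phi> X0) (\<phi> Y0) (\<phi> a0) (\<phi> b0) (\<phi> c0) (\<phi> e0) (\<phi> f0) (\<phi> \<alpha>0)
      (\<phi> \<gamma>0) (\<phi> s0) r2 T1_8 T4_4 T7_3"
    using massey.move_s[OF system_f zs(1)] unfolding zs(2)[symmetric] by blast
  note map_rules = map_rules C.gr_closed[OF s0(1)]
  note rules = rules
    C.gr_closed[OF s0(1)] C.leibniz_even[OF s0(1)] s0(2)
  note degrees = degrees s0(1)
  have wr: "X0 \<otimes>\<^bsub>C\<^esub> \<gamma>0 \<in> gr C 5" "\<partial>\<^bsub>C\<^esub> (X0 \<otimes>\<^bsub>C\<^esub> \<gamma>0) = \<zero>\<^bsub>C\<^esub>"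
    "\<phi> (X0 \<otimes>\<^bsub>C\<^esub> \<gamma>0) = \<partial>\<^bsub>D\<^esub> r2"
    by (simp add: degrees, simp add: rules, simp add: map_rules massey.dif_eqs[OF system_s])
  obtain r0 zr where r0: "r0 \<in> gr C 4" "\<partial>\<^bsub>C\<^esub> r0 = X0 \<otimes>\<^bsub>C\<^esub> \<gamma>0"
    and zr: "zr \<in> gr D 3" "\<phi> r0 = r2 \<oplus>\<^bsub>D\<^esub> \<partial>\<^bsub>D\<^esub> zr"
    using lift[OF massey.in_gr(11)[OF system_s] wr(3)[symmetric] _ wr(2)] wr(1) by auto
  obtain T7_4 where system_r: "massey D (\<phi> X0) (\<phi> Y0) (\<phi> a0) (\<phi> b0) (\<phi> c0) (\<phi> e0) (\<phi> f0) (\<phi> \<alpha>0)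
      (\<phi> \<gamma>0) (\<phi> s0) (\<phi> r0) T1_8 T4_4 T7_4"
    using massey.move_r[OF system_s zr(1)] unfolding zr(2)[symmetric] by blast
  note map_rules = map_rules C.gr_closed[OF r0(1)]
  note rules = rules
    C.gr_closed[OF r0(1)] C.leibniz_even[OF r0(1)] r0(2)
  note degrees = degrees r0(1)
  note closed = C.gr_closed[OF X0(1)] C.gr_closed[OF Y0(1)] C.gr_closed[OF alpha0(1)]
      C.gr_closed[OF gamma0(1)] C.gr_closed[OF a0(1)] C.gr_closed[OF b0(1)] C.gr_closed[OF c0(1)]
      C.gr_closed[OF e0(1)] C.gr_closed[OF f0(1)] C.gr_closed[OF s0(1)] C.gr_closed[OF r0(1)]
  have wT1: "Y0 \<otimes>\<^bsub>C\<^esub> e0 \<oplus>\<^bsub>C\<^esub> a0 \<otimes>\<^bsub>C\<^esub> c0 \<oplus>\<^bsub>C\<^esub> X0 \<otimes>\<^bsub>C\<^esub> f0 \<ominus>\<^bsub>C\<^esub> \<alpha>0 \<otimes>\<^bsub>C\<^esub> \<gamma>0 \<in> gr C 6"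
      "\<partial>\<^bsub>C\<^esub> (Y0 \<otimes>\<^bsub>C\<^esub> e0 \<oplus>\<^bsub>C\<^esub> a0 \<otimes>\<^bsub>C\<^esub> c0 \<oplus>\<^bsub>C\<^esub> X0 \<otimes>\<^bsub>C\<^esub> f0 \<ominus>\<^bsub>C\<^esub> \<alpha>0 \<otimes>\<^bsub>C\<^esub> \<gamma>0) = \<zero>\<^bsub>C\<^esub>"
    "\<phi> (Y0 \<otimes>\<^bsub>C\<^esub> e0 \<oplus>\<^bsub>C\<^esub> a0 \<otimes>\<^bsub>C\<^esub> c0 \<oplus>\<^bsub>C\<^esub> X0 \<otimes>\<^bsub>C\<^esub> f0 \<ominus>\<^bsub>C\<^esub> \<alpha>0 \<otimes>\<^bsub>C\<^esub> \<gamma>0) = \<partial>\<^bsub>D\<^esub> T1_8"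
    by (simp add: degrees, simp add: rules, use closed in algebra, simp add: map_rules
        massey.dif_eqs[OF system_r])
  \<comment> \<open>No other generator is built on \<open>T1\<close>, \<open>T4\<close> or
    \<open>T7\<close>, so a strict primitive suffices and the comparison with the given element of
    \<open>D\<close> is discarded.\<close>
  obtain T10 where T10: "T10 \<in> gr C 5" "\<partial>\<^bsub>C\<^esub> T10 = Y0 \<otimes>\<^bsub>C\<^esub> e0 \<oplus>\<^bsub>C\<^esub> a0 \<otimes>\<^bsub>C\<^esub> c0 \<oplus>\<^bsub>C\<^esub> X0 \<otimes>\<^bsub>C\<^esub> f0 \<ominus>\<^bsub>C\<^esub>
      \<alpha>0 \<otimes>\<^bsub>C\<^esub> \<gamma>0"
    using lift[OF massey.in_gr(12)[OF system_r] wT1(3)[symmetric] _ wT1(2)] wT1(1) by auto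
  have wT4: "a0 \<otimes>\<^bsub>C\<^esub> \<alpha>0 \<ominus>\<^bsub>C\<^esub> X0 \<otimes>\<^bsub>C\<^esub> s0 \<in> gr C 6" "\<partial>\<^bsub>C\<^esub> (a0 \<otimes>\<^bsub>C\<^esub> \<alpha>0 \<ominus>\<^bsub>C\<^esub> X0 \<otimes>\<^bsub>C\<^esub> s0) = \<zero>\<^bsub>C\<^esub>"
    "\<phi> (a0 \<otimes>\<^bsub>C\<^esub> \<alpha>0 \<ominus>\<^bsub>C\<^esub> X0 \<otimes>\<^bsub>C\<^esub> s0) = \<partial>\<^bsub>D\<^esub> T4_4"
    by (simp add: degrees, simp add: rules, simp add: map_rules massey.dif_eqs[OF system_r])
  obtain T40 where T40: "T40 \<in> gr C 5" "\<partial>\<^bsub>C\<^esub> T40 = a0 \<otimes>\<^bsub>C\<^esub> \<alpha>0 \<ominus>\<^bsub>C\<^esub> X0 \<otimes>\<^bsub>C\<^esub> s0"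
    using lift[OF massey.in_gr(13)[OF system_r] wT4(3)[symmetric] _ wT4(2)] wT4(1) by auto
  have wT7: "a0 \<otimes>\<^bsub>C\<^esub> \<gamma>0 \<ominus>\<^bsub>C\<^esub> X0 \<otimes>\<^bsub>C\<^esub> r0 \<in> gr C 6" "\<partial>\<^bsub>C\<^esub> (a0 \<otimes>\<^bsub>C\<^esub> \<gamma>0 \<ominus>\<^bsub>C\<^esub> X0 \<otimes>\<^bsub>C\<^esub> r0) = \<zero>\<^bsub>C\<^esub>"
    "\<phi> (a0 \<otimes>\<^bsub>C\<^esub> \<gamma>0 \<ominus>\<^bsub>C\<^esub> X0 \<otimes>\<^bsub>C\<^esub> r0) = \<partial>\<^bsub>D\<^esub> T7_4"
    by (simp add: degrees, simp add: rules, simp add: map_rules massey.dif_eqs[OF system_r])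
  obtain T70 where T70: "T70 \<in> gr C 5" "\<partial>\<^bsub>C\<^esub> T70 = a0 \<otimes>\<^bsub>C\<^esub> \<gamma>0 \<ominus>\<^bsub>C\<^esub> X0 \<otimes>\<^bsub>C\<^esub> r0"
    using lift[OF massey.in_gr(14)[OF system_r] wT7(3)[symmetric] _ wT7(2)] wT7(1) by auto
  have "massey C X0 Y0 a0 b0 c0 e0 f0 \<alpha>0 \<gamma>0 s0 r0 T10 T40 T70"
    by unfold_locales (fact X0 Y0 a0 b0 c0 e0 f0 alpha0 gamma0 s0 r0 T10 T40 T70)+
  then show ?thesis
    using nondegenerate0 acyclic_pull obstructed unfolding massey_obstructed_def by blast
qed

end

lemma quasi_iso_massey_obstructed_iff:
  assumes "quasi_iso C D \<phi>"
  shows "massey_obstructed C \<longleftrightarrow> massey_obstructed D"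
proof -
  interpret quasi_isomorphism C D \<phi>
    using assms by (simp add: quasi_isomorphism_def quasi_isomorphism_axioms_def quasi_iso_def)
  show ?thesis
    using massey_obstructed_push massey_obstructed_pull by blast
qed

lemma qi_linked_massey_obstructed_iff:
  "qi_linked C D \<Longrightarrow> massey_obstructed C \<longleftrightarrow> massey_obstructed D"
  using quasi_iso_massey_obstructed_iff unfolding qi_linked_def by metis

lemma not_formal_if_massey_obstructed:
  assumes "massey_obstructed A"
  shows "\<not> formal TYPE('u) A"
proof
  assume "formal TYPE('u) A"
  then obtain C D :: "'u dg_alg" where links: "qi_linked A C" "qi_linked\<^sup>*\<^sup>* C D"
      "qi_linked D (cohomology A)"
    unfolding formal_def by blast
  have "massey_obstructed D"
    using links(2)
  proof induction
    case base
    show ?case using qi_linked_massey_obstructed_iff[OF links(1)] assms by simp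
  next
    case (step C' D')
    then show ?case using qi_linked_massey_obstructed_iff by blast
  qed
  then have "massey_obstructed (cohomology A)"
    using qi_linked_massey_obstructed_iff[OF links(3)] by simp
  \<comment> \<open>That the cohomology is itself a cdga is read off the last link of the zigzag,
    since \<open>quasi_iso\<close> includes it.\<close>
  moreover have "cdga (cohomology A)"
    using links(3) unfolding qi_linked_def quasi_iso_def by blast
  ultimately show False
    using cdga.not_massey_obstructed_if_dif_zero[OF _ cohomology_dif_zero] by blast
qed

section \<open>Coefficients in free graded-commutative algebras\<close>

text \<open>The product of \<open>tensor_alg\<close>, detached from the record so that identities
  can be proved for arbitrary functions on words, without conditions on supports.\<close>

definition conv :: "('g list \<Rightarrow> rat) \<Rightarrow> ('g list \<Rightarrow> rat) \<Rightarrow> 'g list \<Rightarrow> rat" where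
  "conv x y w = (\<Sum>k\<le>length w. x (take k w) * y (drop k w))"

definition word :: "'g list \<Rightarrow> 'g list \<Rightarrow> rat" where
  "word v = (\<lambda>w. if w = v then 1 else 0)"

lemma letter_eq_word: "letter g = word [g]"
  by (simp add: letter_def word_def)

lemma conv_Nil: "conv x y [] = x [] * y []"
  by (simp add: conv_def)

text \<open>The cut of the word lies either before \<open>g\<close> or after it; in the latter case
  \<open>g\<close> is absorbed into the left factor, which becomes a shifted function. Coefficients
  of short words are computed with this recursion.\<close>

lemma conv_Cons: "conv x y (g # w) = x [] * y (g # w) + conv (\<lambda>v. x (g # v)) y w"
  by (simp add: conv_def sum.atMost_Suc_shift del: sum.atMost_Suc)

lemma conv_zero_left: "conv (\<lambda>_. 0) y w = 0"
  by (simp add: conv_def)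

lemma conv_add_left: "conv (\<lambda>v. x v + y v) z w = conv x z w + conv y z w"
  by (simp add: conv_def distrib_right sum.distrib)

lemma conv_add_right: "conv z (\<lambda>v. x v + y v) w = conv z x w + conv z y w"
  by (simp add: conv_def distrib_left sum.distrib)

lemma conv_scale_left: "conv (\<lambda>v. q * x v) z w = q * conv x z w"
  by (simp add: conv_def sum_distrib_left mult.assoc)

lemma conv_assoc: "conv (conv x y) z w = conv x (conv y z) w"
\<comment> \<open>The recursion replaces \<open>x\<close> by its shift, so \<open>x\<close> has to
  be general in the induction.\<close>
proof (induction w arbitrary: x)
  case Nil
  show ?case by (simp add: conv_Nil)
next
  case (Cons g w)
  have "conv (conv x y) z (g # w) =
      x [] * y [] * z (g # w) + conv (\<lambda>v. x [] * y (g # v) + conv (\<lambda>u. x (g # u)) y v) z w"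
    by (simp add: conv_Cons conv_Nil)
  also have "\<dots> = x [] * y [] * z (g # w) + (x [] * conv (\<lambda>v. y (g # v)) z w
      + conv (conv (\<lambda>u. x (g # u)) y) z w)"
    by (simp add: conv_add_left conv_scale_left)
  also have "\<dots> = conv x (conv y z) (g # w)"
    by (simp add: conv_Cons Cons.IH algebra_simps)
  finally show ?case .
qed

lemma conv_word_Nil_left: "conv (word []) x w = x w"
  by (cases w) (simp_all add: conv_Nil conv_Cons word_def conv_zero_left)

lemma conv_word_Nil_right: "conv x (word []) w = x w"
  by (induction w arbitrary: x) (simp_all add: conv_Nil conv_Cons, simp_all add: word_def)

lemma conv_letter_word: "conv (letter g) (word v) w = word (g # v) w"
proof (cases w)
  case Nil
  then show ?thesis by (simp add: conv_Nil letter_def word_def)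
next
  case (Cons h u)
  have "conv (\<lambda>v. letter g (h # v)) (word v) u = (if g = h then word v u else 0)"
  proof (cases "g = h")
    case True
    then have "(\<lambda>v. letter g (h # v)) = word []"
      by (auto simp: letter_def word_def)
    with True show ?thesis by (simp add: conv_word_Nil_left)
  next
    case False
    then have "(\<lambda>v. letter g (h # v)) = (\<lambda>_. 0)"
      by (auto simp: letter_def)
    with False show ?thesis by (simp add: conv_zero_left)
  qed
  with Cons show ?thesis
    by (auto simp: conv_Cons letter_def word_def)
qed

lemma conv_support:
  assumes "conv x y w \<noteq> 0"
  obtains u v where "x u \<noteq> 0" "y v \<noteq> 0" "w = u @ v"
proof -
  obtain k where "x (take k w) * y (drop k w) \<noteq> 0"
    using assms unfolding conv_def by (metis (no_types, lifting) sum.neutral)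
  then show thesis
    using that[of "take k w" "drop k w"] by simp
qed

section \<open>The tensor algebra as a ring and an upper bound for the ideal of graded
  commutators\<close>

lemma tensor_alg_carrier:
  "x \<in> carrier (tensor_alg G \<delta>) \<longleftrightarrow> finite {w. x w \<noteq> 0} \<and> (\<forall>w. x w \<noteq> 0 \<longrightarrow> set w \<subseteq> G)"
  by (simp add: tensor_alg_def)

lemma tensor_alg_simps:
  "x \<otimes>\<^bsub>tensor_alg G \<delta>\<^esub> y = conv x y"
  "\<one>\<^bsub>tensor_alg G \<delta>\<^esub> = word []"
  "\<zero>\<^bsub>tensor_alg G \<delta>\<^esub> = (\<lambda>_. 0)"
  "x \<oplus>\<^bsub>tensor_alg G \<delta>\<^esub> y = (\<lambda>w. x w + y w)"
  "q \<odot>\<^bsub>tensor_alg G \<delta>\<^esub> x = (\<lambda>w. q * x w)"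
  by (auto simp: tensor_alg_def conv_def word_def fun_eq_iff)

lemma tensor_alg_gr:
  "x \<in> gr (tensor_alg G \<delta>) n \<longleftrightarrow> x \<in> carrier (tensor_alg G \<delta>) \<and>
      (\<forall>w. x w \<noteq> 0 \<longrightarrow> sum_list (map \<delta> w) = n)"
  by (simp add: tensor_alg_def)

context
  fixes G :: "'g set" and \<delta> :: "'g \<Rightarrow> int"
begin

abbreviation (input) "T \<equiv> tensor_alg G \<delta>"
abbreviation (input) "K \<equiv> comm_ideal G \<delta>"
abbreviation (input) "F \<equiv> free_gca G \<delta>"

lemma word_closed: "set w \<subseteq> G \<Longrightarrow> word w \<in> carrier T"
  by (simp add: tensor_alg_carrier word_def)

lemma conv_closed:
  assumes "x \<in> carrier T" "y \<in> carrier T"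
  shows "conv x y \<in> carrier T"
proof -
  have "{w. conv x y w \<noteq> 0} \<subseteq> (\<lambda>(u, v). u @ v) ` ({w. x w \<noteq> 0} \<times> {w. y w \<noteq> 0})"
    by (auto elim!: conv_support)
  then have "finite {w. conv x y w \<noteq> 0}"
    using assms by (elim finite_subset) (auto simp: tensor_alg_carrier)
  moreover have "set w \<subseteq> G" if "conv x y w \<noteq> 0" for w
    using assms that by (auto simp: tensor_alg_carrier elim!: conv_support) blast+
  ultimately show ?thesis
    by (simp add: tensor_alg_carrier)
qed

lemma add_closed:
  assumes "x \<in> carrier T" "y \<in> carrier T"
  shows "(\<lambda>w. x w + y w) \<in> carrier T"
proof -
  have "{w. x w + y w \<noteq> 0} \<subseteq> {w. x w \<noteq> 0} \<union> {w. y w \<noteq> 0}"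
    by auto
  then have "finite {w. x w + y w \<noteq> 0}"
    using assms by (elim finite_subset) (auto simp: tensor_alg_carrier)
  moreover have "set w \<subseteq> G" if "x w + y w \<noteq> 0" for w
    using that assms unfolding tensor_alg_carrier by (metis add.left_neutral)
  ultimately show ?thesis
    by (simp add: tensor_alg_carrier)
qed

lemma scale_closed:
  assumes "x \<in> carrier T"
  shows "(\<lambda>w. q * x w) \<in> carrier T"
proof -
  have "{w. q * x w \<noteq> 0} \<subseteq> {w. x w \<noteq> 0}"
    by auto
  then have "finite {w. q * x w \<noteq> 0}"
    using assms by (elim finite_subset) (simp add: tensor_alg_carrier)
  then show ?thesis
    using assms by (auto simp: tensor_alg_carrier)
qed

lemma tensor_alg_ring: "ring T"
proof (rule ringI)
  show "abelian_group T"
  proof (rule abelian_groupI)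
    show "\<exists>y\<in>carrier T. y \<oplus>\<^bsub>T\<^esub> x = \<zero>\<^bsub>T\<^esub>" if "x \<in> carrier T" for x
      using scale_closed[OF that, of "- 1"]
      by (intro bexI[of _ "\<lambda>w. - 1 * x w"]) (auto simp: tensor_alg_simps)
  qed (auto simp: tensor_alg_simps add_closed algebra_simps, simp add: tensor_alg_carrier)
  show "Group.monoid T"
    by (rule monoidI) (auto simp: tensor_alg_simps conv_closed word_closed conv_assoc
        conv_word_Nil_left conv_word_Nil_right fun_eq_iff)
qed (auto simp: tensor_alg_simps conv_add_left conv_add_right)

interpretation T: ring T
  by (rule tensor_alg_ring)

lemma tensor_alg_minus: "x \<in> carrier T \<Longrightarrow> \<ominus>\<^bsub>T\<^esub> x = (\<lambda>w. - x w)"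
  using scale_closed[of x "- 1"]
  by (intro T.minus_equality) (auto simp: tensor_alg_simps)

definition sign :: "'g \<Rightarrow> 'g \<Rightarrow> rat" where
  "sign g h = (if even (\<delta> g * \<delta> h) then 1 else - 1)"

definition commutator :: "'g \<Rightarrow> 'g \<Rightarrow> 'g list \<Rightarrow> rat" where
  "commutator g h = (\<lambda>w. word [g, h] w - sign g h * word [h, g] w)"

lemma comm_ideal_eq: "K = Idl\<^bsub>T\<^esub> {commutator g h | g h. g \<in> G \<and> h \<in> G}"
proof -
  have "letter g \<otimes>\<^bsub>T\<^esub> letter h \<ominus>\<^bsub>T\<^esub> koszul T (\<delta> g * \<delta> h) (letter h \<otimes>\<^bsub>T\<^esub> letter g) = commutator g h"
    if "g \<in> G" "h \<in> G" for g h
  proof -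
    have *: "letter u \<otimes>\<^bsub>T\<^esub> letter v = word [u, v]" for u v
      using conv_letter_word[of u "[v]"] by (simp add: tensor_alg_simps fun_eq_iff letter_eq_word)
    show ?thesis
      using that word_closed[of "[h, g]"] scale_closed[OF word_closed[of "[h, g]"], of "- 1"]
      unfolding * commutator_def sign_def koszul_def a_minus_def
      by (simp add: tensor_alg_simps tensor_alg_minus)
  qed
  then have "{letter g \<otimes>\<^bsub>T\<^esub> letter h \<ominus>\<^bsub>T\<^esub> koszul T (\<delta> g * \<delta> h) (letter h \<otimes>\<^bsub>T\<^esub> letter g)
      | g h. g \<in> G \<and> h \<in> G} = {commutator g h | g h. g \<in> G \<and> h \<in> G}"
    by (metis (no_types, lifting))
  then show ?thesis
    by (simp add: comm_ideal_def)
qed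

text \<open>An explicit ideal containing \<open>comm_ideal\<close>. Such an upper bound is enough to
  make coefficients of words of length at most two well defined on the quotient; no normal form for
  words is required.\<close>

definition quadratic_kernel :: "('g list \<Rightarrow> rat) set" where
  "quadratic_kernel = {x \<in> carrier T. x [] = 0 \<and> (\<forall>g. x [g] = 0) \<and>
     (\<forall>g h. x [g, h] + sign g h * x [h, g] = 0)}"

text \<open>The elements have no terms of length 0 or 1. Hence, on words of length two,
  multiplication by \<open>y\<close> is multiplication by the scalar \<open>y []\<close>, which
  preserves the quadratic condition.\<close>

lemma quadratic_kernel_ideal: "ideal quadratic_kernel T"
proof (rule idealI[OF tensor_alg_ring])
  show "subgroup quadratic_kernel (add_monoid T)"
  proof (rule group.subgroupI[OF T.a_group])
    show "quadratic_kernel \<noteq> {}"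
      using T.zero_closed by (auto simp: quadratic_kernel_def tensor_alg_simps)
    show "inv\<^bsub>add_monoid T\<^esub> x \<in> quadratic_kernel" if "x \<in> quadratic_kernel" for x
    proof -
      have "x \<in> carrier T" using that by (simp add: quadratic_kernel_def)
      moreover from this have "(\<lambda>w. - x w) \<in> carrier T"
        using scale_closed[of x "- 1"] by simp
      ultimately show ?thesis
        using that tensor_alg_minus[of x] unfolding a_inv_def[symmetric]
        by (auto simp: quadratic_kernel_def minus_equation_iff[of "_ * _"] add_eq_0_iff)
    qed
    show "x \<otimes>\<^bsub>add_monoid T\<^esub> y \<in> quadratic_kernel"
      if "x \<in> quadratic_kernel" "y \<in> quadratic_kernel" for x y
      using that add_closed[of x y]
      by (auto simp: quadratic_kernel_def tensor_alg_simps algebra_simps add_eq_0_iff)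
  qed (auto simp: quadratic_kernel_def)
  show "y \<otimes>\<^bsub>T\<^esub> x \<in> quadratic_kernel" "x \<otimes>\<^bsub>T\<^esub> y \<in> quadratic_kernel"
    if "x \<in> quadratic_kernel" "y \<in> carrier T" for x y
  proof -
    have x: "x [] = 0" "x [g] = 0" "x [g, h] + sign g h * x [h, g] = 0" for g h
      using that(1) by (simp_all add: quadratic_kernel_def)
    have "conv y x [g, h] + sign g h * conv y x [h, g] = y [] * (x [g, h] + sign g h * x [h, g])"
      "conv x y [g, h] + sign g h * conv x y [h, g] = (x [g, h] + sign g h * x [h, g]) * y []" for
          g h
      by (simp_all add: conv_Cons conv_Nil x(1,2) distrib_left distrib_right)
    then show "y \<otimes>\<^bsub>T\<^esub> x \<in> quadratic_kernel" "x \<otimes>\<^bsub>T\<^esub> y \<in> quadratic_kernel"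
      using that conv_closed[of x y] conv_closed[of y x]
      by (simp_all add: quadratic_kernel_def tensor_alg_simps x conv_Cons[of _ _ _ "[]"] conv_Nil)
  qed
qed

lemma commutator_closed: "g \<in> G \<Longrightarrow> h \<in> G \<Longrightarrow> commutator g h \<in> carrier T"
  using add_closed[OF word_closed[of "[g, h]"]
      scale_closed[OF word_closed[of "[h, g]"], of "- sign g h"]]
  by (simp add: commutator_def)

text \<open>By minimality only the generating commutators need checking. Their coefficients cancel
  because \<open>sign\<close> is symmetric and squares to 1; for \<open>g = h\<close> of odd degree
  the commutator is twice the word \<open>[g, g]\<close>, and the sign is -1.\<close>

lemma comm_ideal_subset: "K \<subseteq> quadratic_kernel"
  unfolding comm_ideal_eq
proof (rule T.genideal_minimal[OF quadratic_kernel_ideal], clarify)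
  fix g h assume gh: "g \<in> G" "h \<in> G"
  have sign: "sign h g = sign g h" "sign u v * sign u v = 1" for u v
    by (simp_all add: sign_def mult.commute)
  have "commutator g h [u, v] + sign u v * commutator g h [v, u] = 0" for u v
    by (cases "u = g"; cases "v = h"; cases "u = h"; cases "v = g")
      (simp_all add: commutator_def word_def sign right_diff_distrib)
  moreover have "commutator g h [] = 0" "commutator g h [u] = 0" for u
    by (simp_all add: commutator_def word_def)
  ultimately show "commutator g h \<in> quadratic_kernel"
    using commutator_closed[OF gh] by (simp add: quadratic_kernel_def)
qed

lemma comm_ideal_ideal: "ideal K T"
  unfolding comm_ideal_eq by (rule T.genideal_ideal) (auto intro: commutator_closed)

interpretation K: ideal K T
  by (rule comm_ideal_ideal)

section \<open>The quotient algebra and the coefficient functionals on it\<close>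

definition free_class :: "('g list \<Rightarrow> rat) \<Rightarrow> ('g list \<Rightarrow> rat) set" where
  "free_class x = K +>\<^bsub>T\<^esub> x"

lemma free_gen_eq: "free_gen G \<delta> g = free_class (letter g)"
  by (simp add: free_gen_def free_class_def)

lemma free_gca_carrier: "carrier F = free_class ` carrier T"
  by (auto simp: free_gca_def quot_gr_alg_def FactRing_def A_RCOSETS_def RCOSETS_def a_r_coset_def
      free_class_def)

lemma free_gca_mult:
  "x \<in> carrier T \<Longrightarrow> y \<in> carrier T \<Longrightarrow> free_class x \<otimes>\<^bsub>F\<^esub> free_class y = free_class (x \<otimes>\<^bsub>T\<^esub> y)"
  by (simp add: free_gca_def quot_gr_alg_def FactRing_def free_class_def K.rcoset_mult_add)

lemma free_gca_add:
  "x \<in> carrier T \<Longrightarrow> y \<in> carrier T \<Longrightarrow> free_class x \<oplus>\<^bsub>F\<^esub> free_class y = free_class (x \<oplus>\<^bsub>T\<^esub> y)"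
  by (simp add: free_gca_def quot_gr_alg_def FactRing_def free_class_def K.a_rcos_sum)

lemma free_gca_zero: "\<zero>\<^bsub>F\<^esub> = free_class \<zero>\<^bsub>T\<^esub>"
  by (simp add: free_gca_def quot_gr_alg_def FactRing_def free_class_def K.a_rcos_const
      K.zero_closed)

lemma free_gca_smult:
  assumes "x \<in> carrier T"
  shows "q \<odot>\<^bsub>F\<^esub> free_class x = free_class (q \<odot>\<^bsub>T\<^esub> x)"
proof -
  have "free_class (q \<odot>\<^bsub>T\<^esub> y) = free_class (q \<odot>\<^bsub>T\<^esub> x)" if y: "y \<in> free_class x" for y
  proof -
    obtain k where k: "k \<in> K" "y = k \<oplus>\<^bsub>T\<^esub> x"
      using y by (auto simp: free_class_def a_r_coset_def r_coset_def)
    \<comment> \<open>An ideal in the sense of rings absorbs products, not scalars; scaling by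
      \<open>q\<close> is therefore rewritten as multiplication by \<open>q\<close> times the
      unit.\<close>
    have "(q \<odot>\<^bsub>T\<^esub> word []) \<otimes>\<^bsub>T\<^esub> k \<in> K"
      using k(1) scale_closed[OF word_closed[of "[]"], of q]
      by (intro K.I_l_closed) (simp_all add: tensor_alg_simps)
    moreover have "(q \<odot>\<^bsub>T\<^esub> word []) \<otimes>\<^bsub>T\<^esub> k = q \<odot>\<^bsub>T\<^esub> k"
      by (simp add: tensor_alg_simps fun_eq_iff conv_scale_left conv_word_Nil_left)
    ultimately have "q \<odot>\<^bsub>T\<^esub> k \<in> K"
      by simp
    moreover have "q \<odot>\<^bsub>T\<^esub> y = (q \<odot>\<^bsub>T\<^esub> k) \<oplus>\<^bsub>T\<^esub> (q \<odot>\<^bsub>T\<^esub> x)"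
      by (simp add: k(2) tensor_alg_simps algebra_simps)
    ultimately have "q \<odot>\<^bsub>T\<^esub> y \<in> free_class (q \<odot>\<^bsub>T\<^esub> x)"
      by (auto simp: free_class_def a_r_coset_def r_coset_def)
    then show ?thesis
      using T.a_repr_independence[OF _ _ K.a_subgroup, of _ "q \<odot>\<^bsub>T\<^esub> x"] scale_closed[OF assms]
      by (simp add: free_class_def tensor_alg_simps)
  qed
  then have "(\<Union>y\<in>free_class x. free_class (q \<odot>\<^bsub>T\<^esub> y)) = (\<Union>y\<in>free_class x. free_class (q \<odot>\<^bsub>T\<^esub> x))"
    by (intro SUP_cong) blast+
  moreover have "x \<in> free_class x"
    using assms K.a_rcos_self by (simp add: free_class_def)
  ultimately have "(\<Union>y\<in>free_class x. free_class (q \<odot>\<^bsub>T\<^esub> y)) = free_class (q \<odot>\<^bsub>T\<^esub> x)"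
    by auto
  then show ?thesis
    by (simp add: free_gca_def quot_gr_alg_def free_class_def)
qed

lemma free_gca_gr: "gr F n = free_class ` gr T n"
  by (auto simp: free_gca_def quot_gr_alg_def free_class_def)

text \<open>Coefficients of single generators are invariant under graded commutation; for words of length
  two the invariant combination is \<open>x\<^sub>g\<^sub>h + (-1)\<^bsup>|g||h|\<^esup> x\<^sub>h\<^sub>g\<close>.\<close>

definition coeff0 :: "('g list \<Rightarrow> rat) set \<Rightarrow> rat" where
  "coeff0 S = (SOME x. x \<in> S) []"

definition coeff1 :: "'g \<Rightarrow> ('g list \<Rightarrow> rat) set \<Rightarrow> rat" where
  "coeff1 g S = (SOME x. x \<in> S) [g]"

definition coeff2 :: "'g \<Rightarrow> 'g \<Rightarrow> ('g list \<Rightarrow> rat) set \<Rightarrow> rat" where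
  "coeff2 g h S = (SOME x. x \<in> S) [g, h] + sign g h * (SOME x. x \<in> S) [h, g]"

text \<open>The representative picked by \<open>SOME\<close> differs from \<open>x\<close> by an
  element of the ideal, and there the three functionals vanish by
  \<open>comm_ideal_subset\<close>.\<close>

lemma coeff_class:
  assumes "x \<in> carrier T"
  shows "coeff0 (free_class x) = x []" "coeff1 g (free_class x) = x [g]"
    "coeff2 g h (free_class x) = x [g, h] + sign g h * x [h, g]"
proof -
  have "x \<in> free_class x"
    using assms K.a_rcos_self by (simp add: free_class_def)
  then have "(SOME y. y \<in> free_class x) \<in> free_class x"
    by (rule someI[of "\<lambda>y. y \<in> free_class x"])
  then obtain k where "k \<in> K" and eq: "(SOME y. y \<in> free_class x) = (\<lambda>w. k w + x w)"
    by (auto simp: free_class_def a_r_coset_def r_coset_def tensor_alg_simps)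
  then have k: "k [] = 0" "k [g] = 0" "k [g, h] + sign g h * k [h, g] = 0" for g h
    using comm_ideal_subset by (auto simp: quadratic_kernel_def)
  show "coeff0 (free_class x) = x []" "coeff1 g (free_class x) = x [g]"
    "coeff2 g h (free_class x) = x [g, h] + sign g h * x [h, g]"
    using k(3)[of g h] by (simp_all add: coeff0_def coeff1_def coeff2_def eq k algebra_simps)
qed

lemma coeff_mult:
  assumes "S \<in> carrier F" "S' \<in> carrier F"
  shows "coeff0 (S \<otimes>\<^bsub>F\<^esub> S') = coeff0 S * coeff0 S'"
    "coeff1 g (S \<otimes>\<^bsub>F\<^esub> S') = coeff0 S * coeff1 g S' + coeff1 g S * coeff0 S'"
    "coeff2 g h (S \<otimes>\<^bsub>F\<^esub> S') = coeff0 S * coeff2 g h S' + coeff1 g S * coeff1 h S'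
       + sign g h * (coeff1 h S * coeff1 g S') + coeff2 g h S * coeff0 S'"
  using assms
  by (auto simp: free_gca_carrier free_gca_mult coeff_class tensor_alg_simps conv_closed conv_Cons
      conv_Nil
      algebra_simps)

lemma coeff_add:
  assumes "S \<in> carrier F" "S' \<in> carrier F"
  shows "coeff0 (S \<oplus>\<^bsub>F\<^esub> S') = coeff0 S + coeff0 S'"
    "coeff1 g (S \<oplus>\<^bsub>F\<^esub> S') = coeff1 g S + coeff1 g S'"
    "coeff2 g h (S \<oplus>\<^bsub>F\<^esub> S') = coeff2 g h S + coeff2 g h S'"
  using assms
  by (auto simp: free_gca_carrier free_gca_add coeff_class tensor_alg_simps add_closed
      algebra_simps)

lemma coeff_smult:
  assumes "S \<in> carrier F"
  shows "coeff0 (q \<odot>\<^bsub>F\<^esub> S) = q * coeff0 S"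
    "coeff1 g (q \<odot>\<^bsub>F\<^esub> S) = q * coeff1 g S"
    "coeff2 g h (q \<odot>\<^bsub>F\<^esub> S) = q * coeff2 g h S"
  using assms
  by (auto simp: free_gca_carrier free_gca_smult coeff_class tensor_alg_simps scale_closed
      algebra_simps)

lemma coeff_zero: "coeff0 \<zero>\<^bsub>F\<^esub> = 0" "coeff1 g \<zero>\<^bsub>F\<^esub> = 0" "coeff2 g h \<zero>\<^bsub>F\<^esub> = 0"
  using T.zero_closed by (simp_all add: free_gca_zero coeff_class tensor_alg_simps)

lemma coeff_gen:
  assumes "u \<in> G"
  shows "coeff0 (free_gen G \<delta> u) = 0" "coeff1 g (free_gen G \<delta> u) = (if g = u then 1 else 0)"
    "coeff2 g h (free_gen G \<delta> u) = 0"
  using assms word_closed[of "[u]"] by (simp_all add: free_gen_eq coeff_class letter_eq_word)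
    (simp_all add: word_def)

lemma free_class_word_Cons:
  assumes "g \<in> G" "set w \<subseteq> G"
  shows "free_class (word (g # w)) = free_gen G \<delta> g \<otimes>\<^bsub>F\<^esub> free_class (word w)"
proof -
  have "letter g \<otimes>\<^bsub>T\<^esub> word w = word (g # w)"
    by (simp add: tensor_alg_simps fun_eq_iff conv_letter_word)
  then show ?thesis
    using assms word_closed[of w] word_closed[of "[g]"]
    by (simp add: free_gen_eq free_gca_mult letter_eq_word)
qed

lemma free_class_word_single: "free_class (word [g]) = free_gen G \<delta> g"
  by (simp add: free_gen_eq letter_eq_word)

text \<open>The last premise concerns only words in the support of \<open>x\<close>. For homogeneous
  \<open>x\<close> of low degree this leaves a short list of words, on which linear statements can
  be checked one by one.\<close>

lemma free_gca_induct:
  assumes x: "x \<in> carrier T"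
    and zero: "P \<zero>\<^bsub>F\<^esub>"
    and add: "\<And>S S'. S \<in> carrier F \<Longrightarrow> S' \<in> carrier F \<Longrightarrow> P S \<Longrightarrow> P S' \<Longrightarrow> P (S \<oplus>\<^bsub>F\<^esub> S')"
    and smult: "\<And>q S. S \<in> carrier F \<Longrightarrow> P S \<Longrightarrow> P (q \<odot>\<^bsub>F\<^esub> S)"
    and word: "\<And>w. x w \<noteq> 0 \<Longrightarrow> P (free_class (word w))"
  shows "P (free_class x)"
proof -
  have "P (free_class y)" if "finite W" "y \<in> carrier T" "{w. y w \<noteq> 0} \<subseteq> W"
      "\<And>w. y w \<noteq> 0 \<Longrightarrow> P (free_class (word w))" for W y
    using that
  proof (induction W arbitrary: y rule: finite_induct)
    case empty
    then have "y = \<zero>\<^bsub>T\<^esub>"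
      by (auto simp: tensor_alg_simps)
    then show ?case
      using zero by (simp add: free_gca_zero)
  next
    case (insert v W)
    define z where "z = y(v := 0)"
    have supp: "y w \<noteq> 0" if "z w \<noteq> 0" for w
      using that by (auto simp: z_def split: if_splits)
    then have z_closed: "z \<in> carrier T"
      using insert.prems(1) finite_subset[of "{w. z w \<noteq> 0}" "{w. y w \<noteq> 0}"]
      by (auto simp: tensor_alg_carrier)
    have "{w. z w \<noteq> 0} \<subseteq> W"
      using insert.prems(2) by (auto simp: z_def)
    then have Pz: "P (free_class z)"
      using insert.IH[OF z_closed] insert.prems(3) supp by blast
    show ?case
    proof (cases "y v = 0")
      case True
      then have "z = y" by (auto simp: z_def)
      with Pz show ?thesis by simp
    next
      case False
      have v: "word v \<in> carrier T"
        using False insert.prems(1) by (intro word_closed) (auto simp: tensor_alg_carrier)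
      have "y = (y v \<odot>\<^bsub>T\<^esub> word v) \<oplus>\<^bsub>T\<^esub> z"
        by (auto simp: tensor_alg_simps z_def word_def)
      then have "free_class y = (y v \<odot>\<^bsub>F\<^esub> free_class (word v)) \<oplus>\<^bsub>F\<^esub> free_class z"
        using v z_closed scale_closed[OF v] by
            (simp add: free_gca_smult free_gca_add tensor_alg_simps)
      moreover have "free_class (word v) \<in> carrier F" "free_class z \<in> carrier F"
          "y v \<odot>\<^bsub>F\<^esub> free_class (word v) \<in> carrier F"
        using v z_closed scale_closed[OF v]
        by (auto simp: free_gca_carrier free_gca_smult tensor_alg_simps)
      ultimately show ?thesis
        using add smult Pz insert.prems(3)[OF False] by simp
    qed
  qed
  then show ?thesis
    using x word by (auto simp: tensor_alg_carrier)
qed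

end

section \<open>The cdga \<open>B\<close>\<close>

context B_construction
begin

abbreviation (input) "G \<equiv> V_gens I \<union> W_gens J"

interpretation cdga B
  by (rule cdga_B)

lemma B_ops:
  "carrier B = carrier (free_gca G gdeg)" "mult B = mult (free_gca G gdeg)"
  "add B = add (free_gca G gdeg)" "zero B = zero (free_gca G gdeg)"
  "smult B = smult (free_gca G gdeg)" "gr B = gr (free_gca G gdeg)"
  unfolding underlying[symmetric] by (simp_all add: gr_alg.defs)

lemma elt_gr:
  assumes "g \<in> G" "gdeg g = n"
  shows "elt g \<in> gr B n"
proof -
  have "word [g] \<in> gr (tensor_alg G gdeg) n"
    using word_closed[of "[g]" G gdeg] assms by (simp add: tensor_alg_gr) (simp add: word_def)
  then show ?thesis
    by (simp add: B_ops free_gca_gr free_gen_eq letter_eq_word)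
qed

lemma elt_closed: "g \<in> G \<Longrightarrow> elt g \<in> carrier B"
  using gr_closed[OF elt_gr[OF _ refl]] .

lemma gens_in:
  "gX \<in> G" "gY \<in> G" "ga \<in> G" "gb \<in> G" "gc \<in> G" "ge \<in> G" "gf \<in> G" "gh \<in> G" "gi \<in> G"
  "galpha \<in> G" "ggamma \<in> G" "gsXalpha \<in> G" "gsYalpha \<in> G" "gsXgamma \<in> G" "gsYgamma \<in> G"
  "l \<in> {1..9} \<Longrightarrow> tgen l \<in> G"
  by (auto simp: V_gens_def W_gens_def)

lemma gens_of_degree:
  assumes "g \<in> G"
  shows "gdeg g \<ge> 2"
    and "gdeg g = 2 \<Longrightarrow> g \<in> {gX, gY}"
    and "gdeg g = 3 \<Longrightarrow> g \<in> {ga, gb, gc, galpha, ggamma}"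
    and "gdeg g = 4 \<Longrightarrow> g \<in> {ge, gf, gsXalpha, gsYalpha, gsXgamma, gsYgamma}"
    and "gdeg g = 5 \<Longrightarrow> g \<in> {gh, gi} \<union> tgen ` {1..9}"
  using assms by (auto simp: V_gens_def W_gens_def)

text \<open>Every generator has degree at least 2, so a word with three or more letters has degree
  at least 6.\<close>

lemma words_of_degree:
  assumes w: "set w \<subseteq> G" and deg: "sum_list (map gdeg w) = n"
  shows "n = 3 \<Longrightarrow> \<exists>g. w = [g] \<and> gdeg g = 3"
    and "n = 4 \<Longrightarrow> (\<exists>g. w = [g] \<and> gdeg g = 4) \<or> (\<exists>g h. w = [g, h] \<and> gdeg g = 2 \<and> gdeg h = 2)"
    and "n = 5 \<Longrightarrow> (\<exists>g. w = [g] \<and> gdeg g = 5) \<or> (\<exists>g h. w = [g, h] \<and> gdeg g = 2 \<and> gdeg h = 3) \<or>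
      (\<exists>g h. w = [g, h] \<and> gdeg g = 3 \<and> gdeg h = 2)"
proof -
  have "w = [] \<or> (\<exists>g. w = [g]) \<or> (\<exists>g h. w = [g, h]) \<or> n \<ge> 6"
  proof (cases w)
    case (Cons g v)
    note g = Cons
    show ?thesis
    proof (cases v)
      case (Cons h u)
      note h = Cons
      show ?thesis
      proof (cases u)
        case (Cons k y)
        have "sum_list (map gdeg y) \<ge> 0"
          using w g h Cons gens_of_degree(1) by (intro sum_list_nonneg) fastforce
        then show ?thesis
          using w deg g h Cons gens_of_degree(1)[of g] gens_of_degree(1)[of h]
              gens_of_degree(1)[of k] by auto
      qed (use g h in simp)
    qed (use g in simp)
  qed simp
  then consider "w = []" "n = 0" | g where "w = [g]" "n = gdeg g"
    | g h where "w = [g, h]" "n = gdeg g + gdeg h" "gdeg g \<ge> 2" "gdeg h \<ge> 2" | "n \<ge> 6"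
    using deg w gens_of_degree(1) by fastforce
  then have "(n = 3 \<longrightarrow> (\<exists>g. w = [g] \<and> gdeg g = 3)) \<and>
    (n = 4 \<longrightarrow> (\<exists>g. w = [g] \<and> gdeg g = 4) \<or> (\<exists>g h. w = [g, h] \<and> gdeg g = 2 \<and> gdeg h = 2)) \<and>
    (n = 5 \<longrightarrow> (\<exists>g. w = [g] \<and> gdeg g = 5) \<or> (\<exists>g h. w = [g, h] \<and> gdeg g = 2 \<and> gdeg h = 3) \<or>
      (\<exists>g h. w = [g, h] \<and> gdeg g = 3 \<and> gdeg h = 2))"
  proof cases
    case 3
    then have "n = 4 \<longrightarrow> gdeg g = 2 \<and> gdeg h = 2"
      "n = 5 \<longrightarrow> gdeg g = 2 \<and> gdeg h = 3 \<or> gdeg g = 3 \<and> gdeg h = 2" "n \<noteq> 3"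
      by linarith+
    with 3(1) show ?thesis by simp
  qed auto
  then show "n = 3 \<Longrightarrow> \<exists>g. w = [g] \<and> gdeg g = 3"
    and "n = 4 \<Longrightarrow> (\<exists>g. w = [g] \<and> gdeg g = 4) \<or> (\<exists>g h. w = [g, h] \<and> gdeg g = 2 \<and> gdeg h = 2)"
    and "n = 5 \<Longrightarrow> (\<exists>g. w = [g] \<and> gdeg g = 5) \<or> (\<exists>g h. w = [g, h] \<and> gdeg g = 2 \<and> gdeg h = 3) \<or>
      (\<exists>g h. w = [g, h] \<and> gdeg g = 3 \<and> gdeg h = 2)"
    by blast+
qed

lemma class_single: "free_class G gdeg (word [g]) = elt g"
  by (rule free_class_word_single)

lemma class_pair: "g \<in> G \<Longrightarrow> k \<in> G \<Longrightarrow> free_class G gdeg (word [g, k]) = elt g \<otimes> elt k"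
  using free_class_word_Cons[of g G "[k]" gdeg] by (simp add: B_ops class_single)

lemma gr_representative:
  assumes "S \<in> gr B n"
  obtains x where "S = free_class G gdeg x" "x \<in> carrier (tensor_alg G gdeg)"
    "\<forall>w. x w \<noteq> 0 \<longrightarrow> set w \<subseteq> G \<and> sum_list (map gdeg w) = n"
  using assms by (auto simp: B_ops free_gca_gr tensor_alg_gr tensor_alg_carrier)

lemmas B_induct = free_gca_induct[of _ G gdeg, folded B_ops]

lemma coeff_rules:
  assumes "S \<in> carrier B" "S' \<in> carrier B"
  shows "coeff0 (S \<otimes> S') = coeff0 S * coeff0 S'"
    "coeff1 g (S \<otimes> S') = coeff0 S * coeff1 g S' + coeff1 g S * coeff0 S'"
    "coeff2 gdeg g k (S \<otimes> S') = coeff0 S * coeff2 gdeg g k S' + coeff1 g S * coeff1 k S'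
       + sign gdeg g k * (coeff1 k S * coeff1 g S') + coeff2 gdeg g k S * coeff0 S'"
    "coeff0 (S \<oplus> S') = coeff0 S + coeff0 S'"
    "coeff1 g (S \<oplus> S') = coeff1 g S + coeff1 g S'"
    "coeff2 gdeg g k (S \<oplus> S') = coeff2 gdeg g k S + coeff2 gdeg g k S'"
  using assms coeff_mult[of S G gdeg S'] coeff_add[of S G gdeg S'] by (simp_all add: B_ops)

lemma coeff_rules_smult:
  assumes "S \<in> carrier B"
  shows "coeff0 (q \<odot> S) = q * coeff0 S" "coeff1 g (q \<odot> S) = q * coeff1 g S"
    "coeff2 gdeg g k (q \<odot> S) = q * coeff2 gdeg g k S"
  using assms coeff_smult[of S G gdeg] by (simp_all add: B_ops)

lemma coeff_rules_zero: "coeff0 \<zero> = 0" "coeff1 g \<zero> = 0" "coeff2 gdeg g k \<zero> = 0"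
  using coeff_zero[where G = G and \<delta> = gdeg] by (simp_all add: B_ops)

lemma coeff_rules_minus:
  assumes "S \<in> carrier B" "S' \<in> carrier B"
  shows "coeff0 (S \<ominus> S') = coeff0 S - coeff0 S'"
    "coeff1 g (S \<ominus> S') = coeff1 g S - coeff1 g S'"
    "coeff2 gdeg g k (S \<ominus> S') = coeff2 gdeg g k S - coeff2 gdeg g k S'"
proof -
  \<comment> \<open>Additivity applied to this identity gives the rules without a formula for
    additive inverses in the quotient.\<close>
  have "S' \<oplus> (S \<ominus> S') = S" "S \<ominus> S' \<in> carrier B"
    using add_diff_cancel assms alg_simps(4) by auto
  then show "coeff0 (S \<ominus> S') = coeff0 S - coeff0 S'"
    "coeff1 g (S \<ominus> S') = coeff1 g S - coeff1 g S'"
    "coeff2 gdeg g k (S \<ominus> S') = coeff2 gdeg g k S - coeff2 gdeg g k S'"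
    using coeff_rules(4-6)[OF assms(2), of "S \<ominus> S'"] by (metis add_diff_cancel_left')+
qed

lemma coeff_rules_elt:
  assumes "u \<in> G"
  shows "coeff0 (elt u) = 0" "coeff1 g (elt u) = (if g = u then 1 else 0)"
      "coeff2 gdeg g k (elt u) = 0"
  using coeff_gen[OF assms, where \<delta> = gdeg] by auto

lemmas coeffs = coeff_rules coeff_rules_smult coeff_rules_zero coeff_rules_minus sign_def
  gens_in[THEN coeff_rules_elt(1)] gens_in[THEN coeff_rules_elt(2)] gens_in[THEN coeff_rules_elt(3)]
  gens_in[THEN elt_closed] dif_closed alg_simps(1,2,4,5)

section \<open>Differentials of \<open>B\<close> in low degrees and the resulting
  obstruction\<close>

lemma elt_low_gr:
  "X \<in> gr B 2" "Y \<in> gr B 2" "a \<in> gr B 3" "b \<in> gr B 3" "c \<in> gr B 3" "e \<in> gr B 4" "f \<in> gr B 4"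
  "\<alpha> \<in> gr B 3" "\<gamma> \<in> gr B 3" "sX\<alpha> \<in> gr B 4" "sX\<gamma> \<in> gr B 4"
  "l \<in> {1..9} \<Longrightarrow> t l \<in> gr B 5"
  by (rule elt_gr, simp only: gens_in, simp)+

lemma massey_B: "massey B X Y a b c e f \<alpha> \<gamma> sX\<alpha> sX\<gamma> (t 1) (t 4) (t 7)"
  by (unfold_locales; (rule d_V d_W elt_low_gr)?; simp)

text \<open>The factors 2 arise because \<open>coeff2\<close> with two equal letters of even degree
  counts the word twice.\<close>

lemma dif_coeffs_degree3:
  assumes "u \<in> gr B 3"
  shows "coeff2 gdeg gX gX (\<partial> u) = 2 * coeff1 ga u \<and> coeff2 gdeg gX gY (\<partial> u) = coeff1 gb u \<and>
    coeff2 gdeg gY gY (\<partial> u) = 2 * coeff1 gc u" (is "?P u")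
proof -
  obtain x where x: "u = free_class G gdeg x" "x \<in> carrier (tensor_alg G gdeg)"
      "\<forall>w. x w \<noteq> 0 \<longrightarrow> set w \<subseteq> G \<and> sum_list (map gdeg w) = 3"
    by (rule gr_representative[OF assms])
  show ?thesis
    unfolding x(1)
  proof (rule B_induct[OF x(2), of ?P])
    fix w assume "x w \<noteq> 0"
    then have w: "set w \<subseteq> G" "sum_list (map gdeg w) = 3"
      using x(3) by auto
    then obtain g where g: "w = [g]" "gdeg g = 3"
      using words_of_degree(1) by blast
    then have "g \<in> {ga, gb, gc, galpha, ggamma}"
      using gens_of_degree(3) w by simp
    then show "?P (free_class G gdeg (word w))"
      unfolding g(1) class_single by (auto simp: d_V d_W coeffs)
  qed (auto simp: dif_zero dif_add dif_smult coeffs)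
qed

text \<open>The differential of each generator of degree 4 contains a monomial that occurs in none
  of the others, such as \<open>Y a\<close> for \<open>e\<close> and \<open>Y b\<close> for
  \<open>f\<close>; products of \<open>X\<close> and \<open>Y\<close> are cocycles.\<close>

lemma dif_coeffs_degree4:
  assumes "u \<in> gr B 4"
  shows "coeff2 gdeg gY ga (\<partial> u) = coeff1 ge u \<and> coeff2 gdeg gY gb (\<partial> u) = coeff1 gf u \<and>
    coeff2 gdeg gX galpha (\<partial> u) = coeff1 gsXalpha u \<and> coeff2 gdeg gY galpha (\<partial> u) = coeff1
        gsYalpha u \<and>
    coeff2 gdeg gX ggamma (\<partial> u) = coeff1 gsXgamma u \<and> coeff2 gdeg gY ggamma (\<partial> u) = coeff1
        gsYgamma u"
    (is "?P u")
proof -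
  obtain x where x: "u = free_class G gdeg x" "x \<in> carrier (tensor_alg G gdeg)"
      "\<forall>w. x w \<noteq> 0 \<longrightarrow> set w \<subseteq> G \<and> sum_list (map gdeg w) = 4"
    by (rule gr_representative[OF assms])
  show ?thesis
    unfolding x(1)
  proof (rule B_induct[OF x(2), of ?P])
    fix w assume "x w \<noteq> 0"
    then have w: "set w \<subseteq> G" "sum_list (map gdeg w) = 4"
      using x(3) by auto
    then consider g where "w = [g]" "gdeg g = 4" | g k where "w = [g, k]" "gdeg g = 2" "gdeg k = 2"
      using words_of_degree(2) by blast
    then show "?P (free_class G gdeg (word w))"
    proof cases
      case 1
      then have "g \<in> {ge, gf, gsXalpha, gsYalpha, gsXgamma, gsYgamma}"
        using gens_of_degree(4) w by simp
      then show ?thesis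
        unfolding 1(1) class_single by (auto simp: d_V d_W coeffs)
    next
      case 2
      then have gk: "g \<in> {gX, gY}" "k \<in> {gX, gY}" "g \<in> G" "k \<in> G"
        using gens_of_degree(2) w by simp_all
      then show ?thesis
        unfolding 2(1) class_pair[OF gk(3,4)]
        by (auto simp: leibniz_even[OF elt_low_gr(1)] leibniz_even[OF elt_low_gr(2)] d_V coeffs)
    qed
  qed (auto simp: dif_zero dif_add dif_smult coeffs)
qed

abbreviation "detect S \<equiv> coeff2 gdeg ga gc S + coeff2 gdeg galpha ggamma S"

text \<open>Among the generators of degree 5, only \<open>t 1\<close> has a differential involving
  \<open>a c\<close> or \<open>\<alpha> \<gamma>\<close>, and there the coefficients are 1 and -1.
  Products of generators of degrees 2 and 3 have differentials without words of length two.\<close>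

lemma detect_boundaries:
  assumes "u \<in> gr B 5"
  shows "detect (\<partial> u) = 0" (is "?P u")
proof -
  obtain x where x: "u = free_class G gdeg x" "x \<in> carrier (tensor_alg G gdeg)"
      "\<forall>w. x w \<noteq> 0 \<longrightarrow> set w \<subseteq> G \<and> sum_list (map gdeg w) = 5"
    by (rule gr_representative[OF assms])
  have low: "coeff0 (\<partial> (elt g)) = 0 \<and> coeff1 k (\<partial> (elt g)) = 0" if
      "g \<in> {ga, gb, gc, galpha, ggamma}" for g k
    using that by (auto simp: d_V d_W coeffs)
  show ?thesis
    unfolding x(1)
  proof (rule B_induct[OF x(2), of ?P])
    fix w assume "x w \<noteq> 0"
    then have w: "set w \<subseteq> G" "sum_list (map gdeg w) = 5"
      using x(3) by auto
    then consider g where "w = [g]" "gdeg g = 5" | g k where "w = [g, k]" "gdeg g = 2" "gdeg k = 3"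
      | g k where "w = [g, k]" "gdeg g = 3" "gdeg k = 2"
      using words_of_degree(3) by blast
    then show "?P (free_class G gdeg (word w))"
    proof cases
      case 1
      then have "g \<in> {gh, gi} \<union> tgen ` {1..9}"
        using gens_of_degree(5) w by simp
      moreover have "{1..9} = {1, 2, 3, 4, 5, 6, 7, 8, 9 :: nat}"
        by auto
      ultimately have "g \<in> {gh, gi, tgen 1, tgen 2, tgen 3, tgen 4, tgen 5, tgen 6, tgen 7, tgen
          8, tgen 9}"
        by auto
      \<comment> \<open>The simplifier turns the index 1 into \<open>Suc 0\<close>; the equation for
        \<open>t 1\<close> must be brought to the same form.\<close>
      then show ?thesis
        unfolding 1(1) class_single by (auto simp: d_V d_W[unfolded One_nat_def] coeffs)
    next
      case 2
      then have gk: "g \<in> {gX, gY}" "k \<in> {ga, gb, gc, galpha, ggamma}" "g \<in> G" "k \<in> G"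
        using gens_of_degree(2,3) w by simp_all
      then have g: "\<partial> (elt g) = \<zero>" "elt g \<in> gr B 2"
        using d_V elt_low_gr by auto
      note closed = elt_closed[OF gk(3)] elt_closed[OF gk(4)]
      have "\<partial> (elt g \<otimes> elt k) = elt g \<otimes> \<partial> (elt k)"
        using leibniz_even[OF g(2)] by (simp add: g(1) closed dif_closed alg_simps)
      then show ?thesis
        unfolding 2(1) class_pair[OF gk(3,4)]
        by (simp add: coeffs closed coeff_rules_elt[OF gk(3)] low[OF gk(2)])
    next
      case 3
      then have gk: "k \<in> {gX, gY}" "g \<in> {ga, gb, gc, galpha, ggamma}" "g \<in> G" "k \<in> G"
        using gens_of_degree(2,3) w by simp_all
      then have g: "\<partial> (elt k) = \<zero>" "elt g \<in> gr B 3"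
        using d_V elt_low_gr by auto
      note closed = elt_closed[OF gk(3)] elt_closed[OF gk(4)]
      have "\<partial> (elt g \<otimes> elt k) = \<partial> (elt g) \<otimes> elt k"
        using leibniz_odd[OF g(2)] by (simp add: g(1) closed dif_closed alg_simps)
      then show ?thesis
        unfolding 3(1) class_pair[OF gk(3,4)]
        by (simp add: coeffs closed coeff_rules_elt[OF gk(4)] low[OF gk(2)])
    qed
  qed (auto simp: dif_zero dif_add dif_smult coeffs simp flip: distrib_left)
qed

lemma pairing_nondegenerate_B: "pairing_nondegenerate B \<alpha> \<gamma>"
  unfolding pairing_nondegenerate_def
proof (intro conjI ballI impI notI)
  have detect: "detect S = 0" if "S \<in> boundaries B 6" for S
    using that detect_boundaries by (auto simp: boundaries_def)
  show False if "\<alpha> \<otimes> \<gamma> \<in> boundaries B 6"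
    using detect[OF that] by (simp add: coeffs)
  show "u \<in> boundaries B 3"
    if u: "u \<in> gr B 3" "\<partial> u = \<zero>" "u \<otimes> \<alpha> \<in> boundaries B 6" "u \<otimes> \<gamma> \<in> boundaries B 6" for u
  proof -
    have "coeff1 ga u = 0" "coeff1 gb u = 0" "coeff1 gc u = 0"
      using dif_coeffs_degree3[OF u(1)] by (simp_all add: u(2) coeffs)
    \<comment> \<open>On \<open>u \<otimes> \<alpha>\<close> the functional \<open>detect\<close>
      returns minus the coefficient of \<gamma> in \<open>u\<close>, on
      \<open>u \<otimes> \<gamma>\<close> the coefficient of \<alpha>.\<close>
    moreover have "coeff1 ggamma u = 0" "coeff1 galpha u = 0"
      using detect[OF u(3)] detect[OF u(4)] gr_closed[OF u(1)] by (simp_all add: coeffs)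
    ultimately have zero: "coeff1 g u = 0" if "g \<in> {ga, gb, gc, galpha, ggamma}" for g
      using that by auto
    obtain x where x: "u = free_class G gdeg x" "x \<in> carrier (tensor_alg G gdeg)"
        "\<forall>w. x w \<noteq> 0 \<longrightarrow> set w \<subseteq> G \<and> sum_list (map gdeg w) = 3"
      by (rule gr_representative[OF u(1)])
    have "x w = 0" for w
    proof (rule ccontr)
      assume nonzero: "x w \<noteq> 0"
      then obtain g where g: "w = [g]" "gdeg g = 3" "g \<in> G"
        using x(3) words_of_degree(1) by fastforce
      then show False
        using nonzero zero gens_of_degree(3)[OF g(3,2)] coeff_class(2)[OF x(2), of g] x(1) by simp
    qed
    then have "u = \<zero>"
      unfolding x(1) B_ops free_gca_zero tensor_alg_simps by (metis ext)
    then show ?thesis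
      using boundariesI[OF gr_zero, of 3] by (simp add: dif_zero)
  qed
qed

text \<open>By \<open>dif_coeffs_degree4\<close> a cocycle has no single-letter terms. It is then a
  combination of \<open>X X\<close>, \<open>X Y\<close> and \<open>Y Y\<close>, which are the
  differentials of \<open>a\<close>, \<open>b\<close> and \<open>c\<close>.\<close>

lemma acyclic_degree4:
  assumes u: "u \<in> gr B 4" "\<partial> u = \<zero>"
  shows "u \<in> boundaries B 4"
proof -
  have zero: "coeff1 g u = 0" if "g \<in> {ge, gf, gsXalpha, gsYalpha, gsXgamma, gsYgamma}" for g
    using that dif_coeffs_degree4[OF u(1)] by (auto simp: u(2) coeffs)
  obtain x where x: "u = free_class G gdeg x" "x \<in> carrier (tensor_alg G gdeg)"
      "\<forall>w. x w \<noteq> 0 \<longrightarrow> set w \<subseteq> G \<and> sum_list (map gdeg w) = 4"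
    by (rule gr_representative[OF u(1)])
  show ?thesis
    unfolding x(1)
  proof (rule B_induct[OF x(2), of "\<lambda>S. S \<in> boundaries B 4"])
    show "\<zero> \<in> boundaries B 4"
      using boundariesI[OF gr_zero, of 4] by (simp add: dif_zero)
    show "q \<odot> S \<in> boundaries B 4" if S: "S \<in> boundaries B 4" for q S
    proof -
      obtain v where v: "v \<in> gr B 3" "S = \<partial> v"
        using S by (auto simp: boundaries_def)
      have "q \<odot> v \<in> gr B 3"
        using submoduleE(4)[OF gr_submodule _ v(1)] by (simp add: rat_field_def)
      then have "\<partial> (q \<odot> v) \<in> boundaries B 4"
        by (intro boundariesI) simp
      then show ?thesis
        using v gr_closed dif_smult by simp
    qed
    fix w assume nonzero: "x w \<noteq> 0"
    then have w: "set w \<subseteq> G" "sum_list (map gdeg w) = 4"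
      using x(3) by auto
    have "\<not> (w = [g] \<and> gdeg g = 4)" for g
      using nonzero zero gens_of_degree(4)[of g] w(1) coeff_class(2)[OF x(2), of g] x(1) by auto
    then obtain g k where gk: "w = [g, k]" "gdeg g = 2" "gdeg k = 2"
      using words_of_degree(2)[OF w] by blast
    then have gk_in: "g \<in> {gX, gY}" "k \<in> {gX, gY}" "g \<in> G" "k \<in> G"
      using gens_of_degree(2) w by simp_all
    have "X \<otimes> X \<in> boundaries B 4" "X \<otimes> Y \<in> boundaries B 4" "Y \<otimes> Y \<in> boundaries B 4"
      using boundariesI[of a 4] boundariesI[of b 4] boundariesI[of c 4] elt_low_gr
      by (simp_all add: d_V)
    moreover have "Y \<otimes> X = X \<otimes> Y"
      using comm_even(1)[OF elt_low_gr(1,2)] by simp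
    ultimately show "free_class G gdeg (word w) \<in> boundaries B 4"
      unfolding gk(1) class_pair[OF gk_in(3,4)] using gk_in(1,2) by auto
  qed (rule boundaries_add)
qed

lemma massey_obstructed_B: "massey_obstructed B"
  unfolding massey_obstructed_def using acyclic_degree4 massey_B pairing_nondegenerate_B by blast

end

theorem proposition4p15:
  fixes I :: "nat \<Rightarrow> 'i set" and J :: "nat \<Rightarrow> 'j set"
    and B :: "(('i, 'j) gens list \<Rightarrow> rat) set dg_alg"
  assumes "B_construction I J B"
  shows "\<not> formal TYPE('u) B"
  using not_formal_if_massey_obstructed[OF B_construction.massey_obstructed_B[OF assms]] .

end
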